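(* Let $d\in\mathbb{N}=\{1,2,\dots\}$, let $f\in\mathbb{R}[X_1,\dots,X_n]_{2d}$, let $p_1,\dots,p_m\in\mathbb{R}[X_1,\dots,X_n]$ all be of degree at most $1$, and let $(P)$ be the problem of minimizing $f$ over the polyhedron $S=\{x\in\mathbb{R}^n : p_1(x)\ge 0,\dots,p_m(x)\ge 0\}$. Suppose that $M_d(y)\in\mathbb{R}^{s_d\times s_d}$ is (the moment matrix of) an optimal solution $y$ of the moment relaxation $(P_{2d})$ and that the modified moment matrix $\widetilde{M_d(y)}$ is a generalized Hankel matrix of order $d$. Then there are $a_1,\dots,a_r\in S$ and weights $\lambda_1>0,\dots,\lambda_r>0$ (for some $r\in\mathbb{N}$) such that $$\widetilde{M_d(y)}=\sum_{i=1}^{r}\lambda_i V_d(a_i)V_d(a_i)^T.$$ Moreover, if $f\in\mathbb{R}[X_1,\dots,X_n]_{2d-1}$, then $a_1,\dots,a_r$ are global minimizers of $(P)$ and $P^*=P^*_{2d}=f(a_i)$ for all $i=1,\dots,r$.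
   Context: Notation. $n\in\mathbb{N}$, $m\in\mathbb{N}_0$; $\mathbb{R}[X_1,\dots,X_n]_k$ is the space of real polynomials of degree at most $k$; $s_k$ is its dimension and $r_k$ is the dimension of the space of forms of degree exactly $k$. $V_k$ is the column vector of all monomials of degree at most $k$, ordered by degree, and $V_k(a)\in\mathbb{R}^{s_k}$ is its evaluation at $a\in\mathbb{R}^n$. For $y=(y_\alpha)_{|\alpha|\le 2d}$ put $M_d(y):=(y_{\alpha+\beta})_{|\alpha|,|\beta|\le d}\in\mathbb{R}^{s_d\times s_d}$. A matrix in $\mathbb{R}^{s_d\times s_d}$ is a generalized Hankel matrix of order $d$ if it equals $M_d(y)$ for some $y\in\mathbb{R}^{s_{2d}}$. For $p=\sum_\gamma p_\gamma X^\gamma\in\mathbb{R}[X_1,\dots,X_n]_k$ and $d_p:=\lfloor (k-\deg p)/2\rfloor$, the localizing matrix is $M_{k,p}(y):=\big(\sum_\gamma p_\gamma y_{\alpha+\beta+\gamma}\big)_{|\alpha|,|\beta|\le d_p}$; in particular $M_{2d,1}(y)=M_d(y)$. $P^*:=\inf\{f(x):x\in S\}$; a global minimizer of $(P)$ is a point $x^*\in S$ with $f(x^* )\le f(x)$ for all $x\in S$. The moment (Lasserre) relaxation $(P_k)$ of degree $k$ (where $f,p_1,\dots,p_m$ have degree at most $k$) is: minimize $\sum_{|\alpha|\le k}f_\alpha y_\alpha$ over $y=(y_\alpha)_{|\alpha|\le k}\in\mathbb{R}^{s_k}$ subject to $y_{(0,\dots,0)}=1$, $M_{k,1}(y)\succeq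 0$, and $M_{k,p_i}(y)\succeq 0$ for $i=1,\dots,m$. Its optimal value is denoted $P^*_k$. One identifies a solution $y$ of $(P_{2d})$ with the matrix $M_d(y)$. Modified moment matrix: a positive semidefinite $M=M_d(y)$ is written in blocks, according to monomials of degree at most $d-1$ and monomials of degree exactly $d$, as $$M=\begin{pmatrix}A_M & A_MW_M\\ W_M^TA_M & C_M\end{pmatrix},$$ where $A_M\in\mathbb{R}^{s_{d-1}\times s_{d-1}}$ and $W_M\in\mathbb{R}^{s_{d-1}\times r_d}$ is some matrix for which the upper right block is $A_MW_M$ (such a matrix always exists). Then $$\widetilde{M}:=\begin{pmatrix}A_M & A_MW_M\\ W_M^TA_M & W_M^TA_MW_M\end{pmatrix},$$ which does not depend on the choice of $W_M$. *)

theory Defs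
  imports "HOL-Analysis.Analysis" "HOL-Library.Poly_Mapping"
begin

text \<open>
  Polynomials in the variables \<open>X\<^sub>i\<close>, \<open>i :: 'n\<close>, with \<open>n = CARD('n)\<close>: finitely supported maps
  from exponents to coefficients. The ring structure is the convolution of
  \<open>HOL-Library.Poly_Mapping\<close>.
\<close>

type_synonym 'n monom = "'n \<Rightarrow>\<^sub>0 nat"
type_synonym 'n mpoly = "'n monom \<Rightarrow>\<^sub>0 real"

definition mdeg :: "'n::finite monom \<Rightarrow> nat" where
  "mdeg \<alpha> = (\<Sum>i\<in>UNIV. Poly_Mapping.lookup \<alpha> i)"

definition monoms_upto :: "nat \<Rightarrow> 'n::finite monom set" where
  "monoms_upto k = {\<alpha>. mdeg \<alpha> \<le> k}"

lemma finite_monoms_upto [simp]: "finite (monoms_upto k :: 'n::finite monom set)"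
proof -
  let ?F = "\<lambda>\<alpha>::'n monom. Poly_Mapping.lookup \<alpha>"
  have "?F ` monoms_upto k \<subseteq> PiE UNIV (\<lambda>_. {..k})"
  proof -
    have "Poly_Mapping.lookup \<alpha> i \<le> mdeg \<alpha>" for \<alpha> :: "'n monom" and i
      unfolding mdeg_def by (rule member_le_sum) auto
    then show ?thesis
      using order_trans by (auto simp: monoms_upto_def PiE_def Pi_def) blast
  qed
  moreover have "finite (PiE (UNIV::'n set) (\<lambda>_. {..k}))"
    by (intro finite_PiE) auto
  ultimately have "finite (?F ` monoms_upto k)"
    by (rule finite_subset)
  moreover have "inj_on ?F (monoms_upto k)"
    by (auto intro!: inj_onI poly_mapping_eqI)
  ultimately show ?thesis
    by (rule finite_imageD)
qed

definition polys_upto :: "nat \<Rightarrow> 'n::finite mpoly set" where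
  "polys_upto k = {p. Poly_Mapping.keys p \<subseteq> monoms_upto k}"

text \<open>Total degree, with the convention that the zero polynomial has degree \<open>0\<close>.\<close>

definition pdeg :: "'n::finite mpoly \<Rightarrow> nat" where
  "pdeg p = Max (insert 0 (mdeg ` Poly_Mapping.keys p))"

definition monom_eval :: "real^'n \<Rightarrow> 'n::finite monom \<Rightarrow> real" where
  "monom_eval x \<alpha> = (\<Prod>i\<in>UNIV. (x $ i) ^ Poly_Mapping.lookup \<alpha> i)"

definition poly_eval :: "'n::finite mpoly \<Rightarrow> real^'n \<Rightarrow> real" where
  "poly_eval p x = (\<Sum>\<gamma>\<in>Poly_Mapping.keys p. Poly_Mapping.lookup p \<gamma> * monom_eval x \<gamma>)"


text \<open>
  Vectors and matrices indexed by the monomials of degree at most \<open>d\<close> are functions vanishing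
  outside \<open>monoms_upto d\<close>, so that equality of matrices is equality of functions.
\<close>

type_synonym 'n mvec = "'n monom \<Rightarrow> real"
type_synonym 'n mmat = "'n monom \<Rightarrow> 'n monom \<Rightarrow> real"

definition V :: "nat \<Rightarrow> real^'n \<Rightarrow> 'n::finite mvec" where
  "V d a = (\<lambda>\<alpha>. if \<alpha> \<in> monoms_upto d then monom_eval a \<alpha> else 0)"

definition psd_on :: "'n monom set \<Rightarrow> 'n mmat \<Rightarrow> bool" where
  "psd_on I M \<longleftrightarrow> (\<forall>\<alpha>\<in>I. \<forall>\<beta>\<in>I. M \<alpha> \<beta> = M \<beta> \<alpha>) \<and>
     (\<forall>v. 0 \<le> (\<Sum>\<alpha>\<in>I. \<Sum>\<beta>\<in>I. v \<alpha> * M \<alpha> \<beta> * v \<beta>))"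

text \<open>
  A sequence \<open>(y\<^sub>\<alpha>)\<close>, \<open>|\<alpha>| \<le> k\<close>, is a total function on exponents; none of the notions below looks
  at its values beyond the relevant degree.
\<close>

definition moment_matrix :: "nat \<Rightarrow> 'n mvec \<Rightarrow> 'n::finite mmat" where
  "moment_matrix d y =
     (\<lambda>\<alpha> \<beta>. if \<alpha> \<in> monoms_upto d \<and> \<beta> \<in> monoms_upto d then y (\<alpha> + \<beta>) else 0)"

definition generalized_Hankel :: "nat \<Rightarrow> 'n::finite mmat \<Rightarrow> bool" where
  "generalized_Hankel d M \<longleftrightarrow> (\<exists>y. M = moment_matrix d y)"

definition loc_order :: "nat \<Rightarrow> 'n::finite mpoly \<Rightarrow> nat" where
  "loc_order k p = (k - pdeg p) div 2"

definition localizing_matrix :: "nat \<Rightarrow> 'n mpoly \<Rightarrow> 'n mvec \<Rightarrow> 'n::finite mmat" where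
  "localizing_matrix k p y =
     (\<lambda>\<alpha> \<beta>. if \<alpha> \<in> monoms_upto (loc_order k p) \<and> \<beta> \<in> monoms_upto (loc_order k p)
        then \<Sum>\<gamma>\<in>Poly_Mapping.keys p. Poly_Mapping.lookup p \<gamma> * y (\<alpha> + \<beta> + \<gamma>) else 0)"

lemma localizing_matrix_one: "localizing_matrix (2 * d) 1 y = moment_matrix d y"
  by (intro ext) (simp add: localizing_matrix_def moment_matrix_def loc_order_def pdeg_def mdeg_def)


definition polyhedron_of :: "nat \<Rightarrow> (nat \<Rightarrow> 'n mpoly) \<Rightarrow> (real^'n::finite) set" where
  "polyhedron_of m p = {x. \<forall>i\<in>{1..m}. poly_eval (p i) x \<ge> 0}"

definition opt_value :: "'n mpoly \<Rightarrow> (real^'n::finite) set \<Rightarrow> ereal" where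
  "opt_value f S = (INF x\<in>S. ereal (poly_eval f x))"

definition global_minimizer :: "'n mpoly \<Rightarrow> (real^'n::finite) set \<Rightarrow> real^'n \<Rightarrow> bool" where
  "global_minimizer f S x \<longleftrightarrow> x \<in> S \<and> (\<forall>z\<in>S. poly_eval f x \<le> poly_eval f z)"

definition relax_feasible :: "nat \<Rightarrow> nat \<Rightarrow> (nat \<Rightarrow> 'n mpoly) \<Rightarrow> 'n::finite mvec set" where
  "relax_feasible k m p = {y. y 0 = 1 \<and>
     psd_on (monoms_upto (loc_order k (1 :: 'n mpoly))) (localizing_matrix k 1 y) \<and>
     (\<forall>i\<in>{1..m}. psd_on (monoms_upto (loc_order k (p i))) (localizing_matrix k (p i) y))}"

definition relax_objective :: "nat \<Rightarrow> 'n mpoly \<Rightarrow> 'n::finite mvec \<Rightarrow> real" where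
  "relax_objective k f y = (\<Sum>\<alpha>\<in>monoms_upto k. Poly_Mapping.lookup f \<alpha> * y \<alpha>)"

definition relax_value :: "nat \<Rightarrow> 'n mpoly \<Rightarrow> nat \<Rightarrow> (nat \<Rightarrow> 'n::finite mpoly) \<Rightarrow> ereal" where
  "relax_value k f m p = (INF y\<in>relax_feasible k m p. ereal (relax_objective k f y))"

definition relax_optimal ::
  "nat \<Rightarrow> 'n mpoly \<Rightarrow> nat \<Rightarrow> (nat \<Rightarrow> 'n mpoly) \<Rightarrow> 'n::finite mvec \<Rightarrow> bool" where
  "relax_optimal k f m p y \<longleftrightarrow> y \<in> relax_feasible k m p \<and>
     (\<forall>z\<in>relax_feasible k m p. relax_objective k f y \<le> relax_objective k f z)"


text \<open>
  The block decomposition of a matrix of order \<open>d \<ge> 1\<close>: \<open>A\<close> is the block on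
  \<open>monoms_upto (d - 1)\<close>, and \<open>W\<close> satisfies that the upper right block is \<open>A W\<close>.
\<close>

definition block_factor :: "nat \<Rightarrow> 'n mmat \<Rightarrow> 'n::finite mmat \<Rightarrow> bool" where
  "block_factor d M W \<longleftrightarrow>
     (\<forall>\<alpha>\<in>monoms_upto (d - 1). \<forall>\<beta>. mdeg \<beta> = d \<longrightarrow>
        M \<alpha> \<beta> = (\<Sum>\<gamma>\<in>monoms_upto (d - 1). M \<alpha> \<gamma> * W \<gamma> \<beta>))"

definition modified_with :: "nat \<Rightarrow> 'n mmat \<Rightarrow> 'n mmat \<Rightarrow> 'n::finite mmat" where
  "modified_with d M W = (\<lambda>\<alpha> \<beta>.
     let J = monoms_upto (d - 1) in
     if \<alpha> \<in> J \<and> \<beta> \<in> J then M \<alpha> \<beta>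
     else if \<alpha> \<in> J \<and> mdeg \<beta> = d then \<Sum>\<gamma>\<in>J. M \<alpha> \<gamma> * W \<gamma> \<beta>
     else if mdeg \<alpha> = d \<and> \<beta> \<in> J then \<Sum>\<gamma>\<in>J. W \<gamma> \<alpha> * M \<gamma> \<beta>
     else if mdeg \<alpha> = d \<and> mdeg \<beta> = d then \<Sum>\<gamma>\<in>J. \<Sum>\<delta>\<in>J. W \<gamma> \<alpha> * M \<gamma> \<delta> * W \<delta> \<beta>
     else 0)"

text \<open>
  For positive semidefinite \<open>M\<close> a factor \<open>W\<close> exists; the choice is immaterial by
  \<open>modified_with_unique\<close> below.
\<close>

definition modified_matrix :: "nat \<Rightarrow> 'n mmat \<Rightarrow> 'n::finite mmat" where
  "modified_matrix d M = modified_with d M (SOME W. block_factor d M W)"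

lemma modified_with_unique:
  fixes M :: "'n::finite mmat"
  assumes sym: "psd_on (monoms_upto d) M"
    and W: "block_factor d M W" and W': "block_factor d M W'"
  shows "modified_with d M W = modified_with d M W'"
proof -
  define J :: "'n monom set" where "J = monoms_upto (d - 1)"
  have J: "J \<subseteq> monoms_upto d"
    by (auto simp: J_def monoms_upto_def)
  have s: "M \<alpha> \<beta> = M \<beta> \<alpha>" if "\<alpha> \<in> J" "\<beta> \<in> J" for \<alpha> \<beta>
    using sym J that unfolding psd_on_def by blast
  have r: "(\<Sum>\<gamma>\<in>J. M \<alpha> \<gamma> * W \<gamma> \<beta>) = (\<Sum>\<gamma>\<in>J. M \<alpha> \<gamma> * W' \<gamma> \<beta>)"
    if "\<alpha> \<in> J" "mdeg \<beta> = d" for \<alpha> \<beta>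
    using W W' that unfolding block_factor_def J_def by metis
  have l: "(\<Sum>\<gamma>\<in>J. W \<gamma> \<alpha> * M \<gamma> \<beta>) = (\<Sum>\<gamma>\<in>J. W' \<gamma> \<alpha> * M \<gamma> \<beta>)"
    if "mdeg \<alpha> = d" "\<beta> \<in> J" for \<alpha> \<beta>
  proof -
    have "(\<Sum>\<gamma>\<in>J. U \<gamma> \<alpha> * M \<gamma> \<beta>) = (\<Sum>\<gamma>\<in>J. M \<beta> \<gamma> * U \<gamma> \<alpha>)" for U :: "'n mmat"
      using s that by (intro sum.cong) auto
    then show ?thesis using r that by simp
  qed
  have c: "(\<Sum>\<gamma>\<in>J. \<Sum>\<delta>\<in>J. W \<gamma> \<alpha> * M \<gamma> \<delta> * W \<delta> \<beta>) = (\<Sum>\<gamma>\<in>J. \<Sum>\<delta>\<in>J. W' \<gamma> \<alpha> * M \<gamma> \<delta> * W' \<delta> \<beta>)"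
    if "mdeg \<alpha> = d" "mdeg \<beta> = d" for \<alpha> \<beta>
  proof -
    have "(\<Sum>\<gamma>\<in>J. \<Sum>\<delta>\<in>J. W \<gamma> \<alpha> * M \<gamma> \<delta> * W \<delta> \<beta>) = (\<Sum>\<gamma>\<in>J. W \<gamma> \<alpha> * (\<Sum>\<delta>\<in>J. M \<gamma> \<delta> * W \<delta> \<beta>))"
      by (simp add: sum_distrib_left mult.assoc)
    also have "\<dots> = (\<Sum>\<gamma>\<in>J. W \<gamma> \<alpha> * (\<Sum>\<delta>\<in>J. M \<gamma> \<delta> * W' \<delta> \<beta>))"
      using r that by (intro sum.cong) auto
    also have "\<dots> = (\<Sum>\<delta>\<in>J. (\<Sum>\<gamma>\<in>J. W \<gamma> \<alpha> * M \<gamma> \<delta>) * W' \<delta> \<beta>)"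
      unfolding sum_distrib_left sum_distrib_right mult.assoc by (rule sum.swap)
    also have "\<dots> = (\<Sum>\<delta>\<in>J. (\<Sum>\<gamma>\<in>J. W' \<gamma> \<alpha> * M \<gamma> \<delta>) * W' \<delta> \<beta>)"
      using l that by (intro sum.cong) auto
    also have "\<dots> = (\<Sum>\<gamma>\<in>J. \<Sum>\<delta>\<in>J. W' \<gamma> \<alpha> * M \<gamma> \<delta> * W' \<delta> \<beta>)"
      unfolding sum_distrib_right by (rule sum.swap)
    finally show ?thesis .
  qed
  show ?thesis
    using r l c unfolding modified_with_def Let_def J_def[symmetric] by (intro ext) simp
qed

end

theory Submission
  imports Defs "HOL-Computational_Algebra.Fundamental_Theorem_Algebra"
begin

text \<open>
  Write \<open>J\<close> and \<open>I\<close> for the monomials of degree at most \<open>d - 1\<close> and at most \<open>d\<close>, and \<open>M\<close> for the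
  moment matrix of \<open>y\<close>. The modified matrix is flat: it has the rank of its block on \<open>J\<close>. Being
  the moment matrix of a sequence \<open>z\<close>, it makes the truncated Gelfand-Naimark-Segal construction
  work. The block on \<open>J\<close> is a positive semidefinite form \<open>B\<close> on polynomials of degree at most
  \<open>d - 1\<close>. The columns of \<open>W\<close> rewrite every monomial of degree \<open>d\<close> as a polynomial of lower
  degree without changing any value of the form (\<open>gram_reduce\<close>), so that multiplying by a variable
  and rewriting the result gives operators \<open>mult_var i\<close> from these polynomials to themselves. The
  Hankel structure says that the form depends on the product of its arguments only, and hence
  that these operators are self-adjoint and commute, up to polynomials of seminorm zero.

  Commuting self-adjoint operators have a common orthogonal eigenvector decomposition. Apply it to
  the constant polynomial \<open>1\<close>, with a component \<open>e a\<close> for each tuple \<open>a\<close> of eigenvalues, which is a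
  point of \<open>\<real>\<^sup>n\<close>. Up to seminorm zero, a monomial \<open>\<alpha>\<close> of degree at most \<open>d\<close> is the result of
  multiplying \<open>1\<close> by variables, hence equals the sum of the \<open>a\<^sup>\<alpha> e a\<close>. Orthogonality then turns
  \<open>z (\<alpha> + \<beta>)\<close> into the sum of the \<open>B (e a) (e a) a\<^sup>\<alpha> a\<^sup>\<beta>\<close> (\<open>atomic_decomposition\<close>): the atoms are the
  joint eigenvalues and the weights are the squared seminorms.

  Each atom lies in the polyhedron because, for a polynomial \<open>p\<close> of degree at most \<open>1\<close>, the
  localizing form of \<open>p\<close> at the eigenvector \<open>e a\<close> is \<open>p(a) B (e a) (e a)\<close>. This
  form involves moments of degree at most \<open>2 d - 1\<close> only, and there \<open>z\<close> agrees with the feasible \<open>y\<close>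
  (\<open>localizing_form_eigenvector\<close>, \<open>hankel_agrees\<close>). If \<open>f\<close> has degree at most \<open>2 d - 1\<close>, the optimal value of the
  relaxation is for the same reason the weighted average of \<open>f\<close> over the atoms. It is also a lower bound for
  \<open>f\<close> on the polyhedron, since point evaluations are feasible, so \<open>f\<close> attains the bound at every
  atom.
\<close>

section \<open>Polynomials as a real vector space\<close>

instantiation poly_mapping :: (type, real_vector) real_vector
begin

lift_definition scaleR_poly_mapping :: "real \<Rightarrow> ('a \<Rightarrow>\<^sub>0 'b) \<Rightarrow> ('a \<Rightarrow>\<^sub>0 'b)"
  is "\<lambda>r f k. r *\<^sub>R f k"
proof -
  fix r and f :: "'a \<Rightarrow> 'b"
  assume "finite {k. f k \<noteq> 0}"
  then show "finite {k. r *\<^sub>R f k \<noteq> 0}"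
    by (rule rev_finite_subset) auto
qed

instance
  by standard (transfer; simp add: fun_eq_iff scaleR_add_right scaleR_add_left)+

end

lemma lookup_scaleR [simp]: "Poly_Mapping.lookup (r *\<^sub>R g) k = r *\<^sub>R Poly_Mapping.lookup g k"
  by transfer simp


section \<open>Positive semidefinite forms\<close>

text \<open>
  Vectors of seminorm zero are kept instead of being divided out: the quotient of a space of
  polynomials by the kernel of a moment matrix would depend on \<open>d\<close> and \<open>y\<close> and so is not a type.
  All statements about operators below hold up to null vectors.
\<close>

locale semi_inner =
  fixes B :: "'a::real_vector \<Rightarrow> 'a \<Rightarrow> real"
  assumes add_left: "B (u + v) w = B u w + B v w"
    and scale_left: "B (r *\<^sub>R u) w = r * B u w"
    and commute: "B u v = B v u"
    and nonneg: "0 \<le> B u u"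
begin

lemma add_right: "B w (u + v) = B w u + B w v"
  using add_left commute by metis

lemma scale_right: "B w (r *\<^sub>R u) = r * B w u"
  using scale_left commute by metis

lemma linear_left: "linear (\<lambda>u. B u w)"
  by (rule linearI) (simp_all add: add_left scale_left)

lemma zero_left [simp]: "B 0 w = 0"
  using linear_0[OF linear_left] .

lemma diff_left: "B (u - v) w = B u w - B v w"
  using linear_diff[OF linear_left] .

lemma sum_left: "B (\<Sum>i\<in>I. g i) w = (\<Sum>i\<in>I. B (g i) w)"
  using linear_sum[OF linear_left] .

lemma diff_right: "B w (u - v) = B w u - B w v"
  using diff_left commute by metis

lemma sum_right: "B w (\<Sum>i\<in>I. g i) = (\<Sum>i\<in>I. B w (g i))"
  using sum_left commute by (metis (mono_tags, lifting) sum.cong)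

lemma form_sums:
  "B (\<Sum>i\<in>I. a i *\<^sub>R g i) (\<Sum>j\<in>K. b j *\<^sub>R h j)
    = (\<Sum>i\<in>I. \<Sum>j\<in>K. a i * b j * B (g i) (h j))"
  unfolding sum_left by (simp add: scale_left scale_right sum_right mult_ac)

definition null :: "'a \<Rightarrow> bool"
  where "null u \<longleftrightarrow> (\<forall>w. B u w = 0)"

lemma null_left: "null u \<Longrightarrow> B u w = 0"
  by (simp add: null_def)

lemma null_right: "null u \<Longrightarrow> B w u = 0"
  by (simp add: null_def commute[of w])

text \<open>
  The Cauchy-Schwarz argument: for \<open>B u u = 0\<close> the squared seminorm of \<open>w + t u\<close> is affine in \<open>t\<close>,
  and a nonnegative affine function is constant.
\<close>

lemma null_if_norm_zero:
  assumes "B u u = 0"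
  shows "null u"
  unfolding null_def
proof (rule allI, rule ccontr)
  fix w
  assume "B u w \<noteq> 0"
  \<comment> \<open>The value of \<open>t\<close> at which the affine function is \<open>- 1\<close>.\<close>
  define t where "t = - (B w w + 1) / (2 * B u w)"
  have "0 \<le> B (w + t *\<^sub>R u) (w + t *\<^sub>R u)"
    by (rule nonneg)
  also have "\<dots> = B w w + 2 * t * B u w"
    using assms by (simp add: add_left add_right scale_left scale_right commute[of w u])
  also have "\<dots> = - 1"
    using \<open>B u w \<noteq> 0\<close> by (simp add: t_def field_simps)
  finally show False
    by simp
qed

lemma null_add: "null u \<Longrightarrow> null v \<Longrightarrow> null (u + v)"
  by (simp add: null_def add_left)

lemma subspace_null: "subspace {u. null u}"
  by (rule subspaceI) (auto simp: null_def add_left scale_left)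

text \<open>
  Gram-Schmidt, one vector at a time. Subtracting from the new vector \<open>h\<close> its projection leaves \<open>k\<close>;
  if \<open>k\<close> has seminorm zero, it is orthogonal to everything and needs no correction, which the
  convention \<open>r / 0 = 0\<close> provides.
\<close>

lemma orthogonal_projection_exists:
  assumes "finite F"
  shows "\<exists>w\<in>span F. \<forall>g\<in>F. B (x - w) g = 0"
  using assms
proof (induction F arbitrary: x)
  case empty
  then show ?case by (auto intro: span_zero)
next
  case (insert h F)
  have ins: "w \<in> span F \<Longrightarrow> w \<in> span (insert h F)" for w
    using span_mono[of F "insert h F"] by blast
  obtain hp where hp: "hp \<in> span F" "\<forall>g\<in>F. B (h - hp) g = 0"
    using insert.IH by blast
  obtain xp where xp: "xp \<in> span F" "\<forall>g\<in>F. B (x - xp) g = 0"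
    using insert.IH by blast
  have orth: "B u g = 0" if "\<forall>g\<in>F. B u g = 0" "g \<in> span F" for u g
    using that(2)
    by (induction rule: span_induct) (auto simp: subspace_def add_right scale_right that(1) commute[of u 0])
  define k where "k = h - hp"
  define w where "w = xp + (B x k / B k k) *\<^sub>R k"
  have "k \<in> span (insert h F)"
    unfolding k_def using ins[OF hp(1)] by (simp add: span_diff span_base)
  then have "w \<in> span (insert h F)"
    unfolding w_def using ins[OF xp(1)] by (intro span_add span_scale)
  moreover have F: "B (x - w) g = 0" if "g \<in> F" for g
    using that hp(2) xp(2)
    by (simp add: w_def diff_left add_left scale_left k_def)
  moreover have "B (x - w) h = 0"
  proof -
    have "B (x - w) k = 0"
    proof (cases "B k k = 0")
      case True
      then show ?thesis
        using null_if_norm_zero null_right by blast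
    next
      case False
      have "B xp k = 0"
        using orth[OF hp(2) xp(1)] commute[of xp] by (simp add: k_def)
      then show ?thesis
        using False by (simp add: w_def diff_left add_left scale_left)
    qed
    moreover have "B (x - w) hp = 0"
      using orth[OF _ hp(1)] F by blast
    ultimately show ?thesis
      by (simp add: k_def diff_right)
  qed
  ultimately show ?case
    by auto
qed

end


section \<open>Polynomials in a linear operator\<close>

definition poly_op :: "('a::real_vector \<Rightarrow> 'a) \<Rightarrow> real poly \<Rightarrow> 'a \<Rightarrow> 'a"
  where "poly_op T q v = (\<Sum>k\<le>degree q. coeff q k *\<^sub>R (T ^^ k) v)"

lemma poly_op_altdef:
  assumes "degree q \<le> n"
  shows "poly_op T q v = (\<Sum>k\<le>n. coeff q k *\<^sub>R (T ^^ k) v)"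
  unfolding poly_op_def
  using assms by (intro sum.mono_neutral_left) (auto simp: coeff_eq_0)

lemma poly_op_0 [simp]: "poly_op T 0 v = 0"
  by (simp add: poly_op_def)

lemma poly_op_add: "poly_op T (p + q) v = poly_op T p v + poly_op T q v"
proof -
  define n where "n = max (degree p) (degree q)"
  have "degree p \<le> n" "degree q \<le> n" "degree (p + q) \<le> n"
    by (auto simp: n_def intro: degree_add_le)
  then show ?thesis
    by (simp add: poly_op_altdef[of _ n] scaleR_add_left sum.distrib)
qed

lemma poly_op_smult: "poly_op T (smult c q) v = c *\<^sub>R poly_op T q v"
  by (simp add: poly_op_altdef[of _ "degree q"] degree_smult_le scaleR_sum_right)

lemma poly_op_pCons:
  assumes "linear T"
  shows "poly_op T (pCons a q) v = a *\<^sub>R v + T (poly_op T q v)"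
proof -
  have "poly_op T (pCons a q) v = (\<Sum>k\<le>Suc (degree q). coeff (pCons a q) k *\<^sub>R (T ^^ k) v)"
    by (rule poly_op_altdef) (simp add: degree_pCons_le)
  also have "\<dots> = a *\<^sub>R v + (\<Sum>k\<le>degree q. coeff q k *\<^sub>R T ((T ^^ k) v))"
    by (subst sum.atMost_Suc_shift) simp
  also have "(\<Sum>k\<le>degree q. coeff q k *\<^sub>R T ((T ^^ k) v)) = T (poly_op T q v)"
    using assms by (simp add: poly_op_def linear_sum linear_scale)
  finally show ?thesis .
qed

lemma poly_op_mult:
  assumes "linear T"
  shows "poly_op T (p * q) v = poly_op T p (poly_op T q v)"
  by (induction p) (simp_all add: poly_op_pCons[OF assms] poly_op_add poly_op_smult mult_pCons_left)

text \<open>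
  A finite-dimensional space contains \<open>v\<close> and all its iterates. Either two of the first
  \<open>card F + 2\<close> iterates coincide or they are linearly dependent, and both give a polynomial.
\<close>

lemma annihilating_polynomial_exists:
  fixes T :: "'a::real_vector \<Rightarrow> 'a"
  assumes "finite F" "\<And>u. T u \<in> span F"
  shows "\<exists>q. q \<noteq> 0 \<and> poly_op T q v = 0"
proof -
  define n where "n = Suc (card F)"
  define g where "g k = (T ^^ k) v" for k
  have poly: "\<exists>q. q \<noteq> 0 \<and> poly_op T q v = 0"
    if c: "(\<Sum>k\<le>n. c k *\<^sub>R g k) = 0" "i \<le> n" "c i \<noteq> 0" for c i
  proof -
    define q where "q = (\<Sum>k\<le>n. monom (c k) k)"
    have co: "coeff q k = (if k \<le> n then c k else 0)" for k
      by (simp add: q_def coeff_sum)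
    have "degree q \<le> n"
      by (rule degree_le) (simp add: co)
    then have "poly_op T q v = 0"
      using c(1) by (simp add: poly_op_altdef co g_def)
    moreover have "q \<noteq> 0"
      using co[of i] c by auto
    ultimately show ?thesis by blast
  qed
  show ?thesis
  proof (cases "inj_on g {..n}")
    case False
    then obtain i j where ij: "i \<le> n" "j \<le> n" "i \<noteq> j" "g i = g j"
      by (auto simp: inj_on_def)
    define c :: "nat \<Rightarrow> real" where "c k = (if k = i then 1 else 0) - (if k = j then 1 else 0)" for k
    have "(\<Sum>k\<le>n. c k *\<^sub>R g k)
        = (\<Sum>k\<le>n. (if k = i then g k else 0)) - (\<Sum>k\<le>n. (if k = j then g k else 0))"
      unfolding sum_subtractf[symmetric] by (rule sum.cong) (auto simp: c_def scaleR_diff_left)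
    also have "\<dots> = 0"
      using ij by simp
    finally show ?thesis
      using ij by (intro poly[of c i]) (auto simp: c_def)
  next
    case True
    have "g k \<in> span (insert v F)" for k
    proof (cases k)
      case 0
      then show ?thesis by (simp add: g_def span_base)
    next
      case (Suc l)
      then show ?thesis
        using assms(2)[of "g l"] span_mono[of F "insert v F"] by (auto simp: g_def)
    qed
    moreover have "card (g ` {..n}) = Suc n"
      using True by (simp add: card_image)
    moreover have "card (insert v F) \<le> n"
      using assms(1) by (simp add: n_def card_insert_if)
    ultimately have "dependent (g ` {..n})"
      using independent_span_bound[of "insert v F" "g ` {..n}"] assms(1) by fastforce
    then obtain u i where u: "i \<le> n" "u (g i) \<noteq> 0" "(\<Sum>x\<in>g ` {..n}. u x *\<^sub>R x) = 0"
      by (auto simp: dependent_finite)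
    show ?thesis
      using u True by (intro poly[of "u \<circ> g" i]) (auto simp: sum.reindex)
  qed
qed

text \<open>
  A nonreal complex root \<open>a + b i\<close> is also a root of the remainder modulo \<open>(x - a)\<^sup>2 + b\<^sup>2\<close>; a real
  polynomial of degree at most \<open>1\<close> with a nonreal root is zero.
\<close>

lemma real_poly_factor:
  fixes q :: "real poly"
  assumes "degree q > 0"
  obtains (real_root) c s where "q = [:- c, 1:] * s"
    | (complex_roots) a b s where "b \<noteq> 0" "q = [:a\<^sup>2 + b\<^sup>2, - (2 * a), 1:] * s"
proof -
  define e where "e p z = poly (map_poly complex_of_real p) z" for p z
  have e_pCons: "e (pCons a p) z = of_real a + z * e p z" for a p z
    by (simp add: e_def map_poly_pCons)
  have e_0: "e 0 z = 0" for z
    by (simp add: e_def)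
  have e_add: "e (p + r) z = e p z + e r z" for p r z
    by (induction p r rule: poly_induct2) (simp_all add: e_0 e_pCons algebra_simps)
  have e_smult: "e (smult a p) z = of_real a * e p z" for a p z
    by (induction p) (simp_all add: e_0 e_pCons algebra_simps)
  have e_mult: "e (p * r) z = e p z * e r z" for p r z
    by (induction p) (simp_all add: e_0 e_pCons e_add e_smult mult_pCons_left algebra_simps)
  have "degree (map_poly complex_of_real q) = degree q"
    by (rule degree_map_poly) simp
  then have "\<not> constant (poly (map_poly complex_of_real q))"
    using assms by (simp add: constant_degree)
  then obtain z where z: "e q z = 0"
    using fundamental_theorem_of_algebra unfolding e_def by blast
  show thesis
  proof (cases "Im z = 0")
    case True
    have er: "e p (of_real x) = of_real (poly p x)" for p x
      by (induction p) (simp_all add: e_0 e_pCons)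
    have "z = of_real (Re z)"
      using True by (simp add: complex_eq_iff)
    then have "complex_of_real (poly q (Re z)) = 0"
      using z er by metis
    then have "[:- Re z, 1:] dvd q"
      by (simp add: poly_eq_0_iff_dvd)
    then show ?thesis
      using real_root by (auto elim: dvdE)
  next
    case False
    define p where "p = [:(Re z)\<^sup>2 + (Im z)\<^sup>2, - (2 * Re z), 1:]"
    define r where "r = q mod p"
    have ep: "e p z = 0"
      by (simp add: p_def e_0 e_pCons complex_eq_iff power2_eq_square algebra_simps)
    have q: "q = p * (q div p) + r"
      by (simp add: r_def)
    then have er: "e r z = 0"
      using z ep by (metis add.left_neutral e_add e_mult mult_zero_left)
    have "degree r < 2"
      using degree_mod_less[of p q] by (auto simp: r_def p_def)
    then have "r = [:coeff r 0, coeff r 1:]"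
      by (auto simp: poly_eq_iff coeff_pCons coeff_eq_0 numeral_2_eq_2 split: nat.split)
    then have "of_real (coeff r 0) + z * of_real (coeff r 1) = 0"
      using er by (metis add.right_neutral e_0 e_pCons mult_zero_right)
    then have "coeff r 1 = 0" "coeff r 0 = 0"
      using False by (auto simp: complex_eq_iff)
    then have "r = 0"
      using \<open>r = [:coeff r 0, coeff r 1:]\<close> by simp
    then show ?thesis
      using complex_roots[of "Im z" "Re z" "q div p"] False q by (simp add: p_def)
  qed
qed


section \<open>Simultaneous diagonalization\<close>

context semi_inner
begin

text \<open>Null vectors count as eigenvectors, for every eigenvalue; this makes the spans below absorb them.\<close>

definition eigenvector :: "('a \<Rightarrow> 'a) \<Rightarrow> real \<Rightarrow> 'a \<Rightarrow> bool"
  where "eigenvector T c u \<longleftrightarrow> null (T u - c *\<^sub>R u)"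

definition self_adjoint :: "('a \<Rightarrow> 'a) \<Rightarrow> bool"
  where "self_adjoint T \<longleftrightarrow> linear T \<and> (\<forall>u v. B (T u) v = B u (T v))"

lemma self_adjoint_null:
  "self_adjoint T \<Longrightarrow> null u \<Longrightarrow> null (T u)"
  by (simp add: self_adjoint_def null_def)

lemma self_adjoint_shift:
  "self_adjoint T \<Longrightarrow> self_adjoint (\<lambda>u. T u - c *\<^sub>R u)"
  unfolding self_adjoint_def
  by (auto intro!: linearI simp: linear_add linear_scale diff_left diff_right scale_left scale_right
      algebra_simps)

lemma subspace_eigenvector:
  assumes "self_adjoint T"
  shows "subspace {u. eigenvector T c u}"
proof -
  have "linear (\<lambda>u. T u - c *\<^sub>R u)"
    using self_adjoint_shift[OF assms] by (simp add: self_adjoint_def)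
  from linear_subspace_vimage[OF this subspace_null] show ?thesis
    by (simp add: eigenvector_def vimage_def)
qed

text \<open>Self-adjoint operators have no nilpotent part.\<close>

lemma null_image_if_null_square:
  assumes "self_adjoint T" "null (T (T u))"
  shows "null (T u)"
proof -
  have "B (T u) (T u) = B (T (T u)) u"
    using assms(1) by (simp add: self_adjoint_def)
  then show ?thesis
    using assms(2) by (simp add: null_left null_if_norm_zero)
qed

text \<open>
  Induction on the degree of the annihilating polynomial. A quadratic factor \<open>(x - a)\<^sup>2 + b\<^sup>2\<close>
  can be dropped: if it sends \<open>w\<close> to a null vector, then the squared seminorm of \<open>(T - a) w\<close> plus
  \<open>b\<^sup>2\<close> times that of \<open>w\<close> vanishes. For a factor \<open>x - c\<close>, the induction hypothesis decomposes \<open>(T - c) v\<close>.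
  Dividing by \<open>k - c\<close> the components with eigenvalue \<open>k \<noteq> c\<close> yields \<open>w\<close> such that \<open>(T - c)\<^sup>2 (v - w)\<close>
  is null, and then so is \<open>(T - c) (v - w)\<close>.

  The invariant subspace \<open>U\<close> is there for joint diagonalization, where it is an eigenspace of the
  operators treated before.
\<close>

lemma in_span_eigenvectors_if_annihilated:
  assumes T: "self_adjoint T" and U: "subspace U" "\<And>u. u \<in> U \<Longrightarrow> T u \<in> U"
    and "q \<noteq> 0" "v \<in> U" "null (poly_op T q v)"
  shows "v \<in> span {u \<in> U. \<exists>c. eigenvector T c u}"
  using assms(4-6)
proof (induction "degree q" arbitrary: q v rule: less_induct)
  case less
  let ?E = "{u \<in> U. \<exists>c. eigenvector T c u}"
  have lin: "linear T"
    using T by (simp add: self_adjoint_def)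
  have null_in_E: "u \<in> ?E" if "u \<in> U" "null u" for u
    using that self_adjoint_null[OF T] by (auto simp: eigenvector_def intro!: exI[of _ 0])
  show ?case
  proof (cases "degree q = 0")
    case True
    then obtain c where q: "q = [:c:]"
      using degree_eq_zeroE by blast
    then have "c \<noteq> 0" "null (c *\<^sub>R v)"
      using less.prems by (auto simp: poly_op_def)
    then have "null v"
      using scale_left by (simp add: null_def)
    then show ?thesis
      using null_in_E less.prems by (intro span_base) auto
  next
    case False
    then have "degree q > 0" by simp
    then show ?thesis
    proof (cases rule: real_poly_factor)
      case (real_root c s)
      let ?S = "\<lambda>u. T u - c *\<^sub>R u"
      have S: "self_adjoint ?S"
        by (rule self_adjoint_shift[OF T])
      then have linS: "linear ?S"
        by (simp add: self_adjoint_def)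
      have "poly_op T q v = poly_op T s (?S v)"
      proof -
        have "poly_op T q v = poly_op T s (poly_op T [:- c, 1:] v)"
          unfolding real_root poly_op_mult[OF lin, symmetric] by (simp add: mult.commute)
        also have "poly_op T [:- c, 1:] v = ?S v"
          by (simp add: poly_op_pCons[OF lin] linear_0[OF lin])
        finally show ?thesis .
      qed
      moreover have "s \<noteq> 0"
        using less.prems real_root by auto
      moreover from this have "degree s < degree q"
        by (simp add: real_root degree_mult_eq del: mult_pCons_left)
      moreover have "?S v \<in> U"
        using U less.prems by (intro subspace_diff subspace_scale) auto
      ultimately have Sv: "?S v \<in> span ?E"
        using less by metis
      \<comment> \<open>Solve \<open>(T - c) w = x\<close> up to vectors that \<open>T - c\<close> maps to null vectors.\<close>
      have solve: "\<exists>w\<in>span ?E. w \<in> U \<and> null (?S (x - ?S w))" if "x \<in> span ?E" for x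
        using that
      proof (induction rule: span_induct_alt)
        case base
        show ?case
          using linear_0[OF linS] linear_0[OF lin] subspace_0[OF U(1)]
          by (intro bexI[of _ 0]) (auto simp: span_zero null_def)
      next
        case (step t e x)
        then obtain w where w: "w \<in> span ?E" "w \<in> U" "null (?S (x - ?S w))"
          by blast
        obtain k where e: "e \<in> U" "eigenvector T k e"
          using step by blast
        define g where "g = (if k = c then 0 else 1 / (k - c)) *\<^sub>R e"
        have gE: "g \<in> span ?E"
          unfolding g_def by (intro span_scale span_base step.hyps)
        have gU: "g \<in> U"
          unfolding g_def by (intro subspace_scale U e)
        have n0: "null (T e - k *\<^sub>R e)"
          using e(2) by (simp add: eigenvector_def)
        have ng: "null (?S (e - ?S g))"
        proof (cases "k = c")
          case True
          then show ?thesis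
            using n0 linear_0[OF lin] by (simp add: g_def)
        next
          case False
          have "e - ?S g = (- 1 / (k - c)) *\<^sub>R (T e - k *\<^sub>R e)"
          proof -
            have "(k - c) *\<^sub>R (e - ?S g) = (k - c) *\<^sub>R e - (T e - c *\<^sub>R e)"
              using False by (simp add: g_def linear_scale[OF lin] scaleR_diff_right)
            also have "\<dots> = - (T e - k *\<^sub>R e)"
              by (simp add: algebra_simps)
            finally have "(1 / (k - c)) *\<^sub>R ((k - c) *\<^sub>R (e - ?S g)) = (1 / (k - c)) *\<^sub>R (- (T e - k *\<^sub>R e))"
              by (rule arg_cong)
            then show ?thesis
              using False by (simp flip: scaleR_minus_right)
          qed
          then have "null (e - ?S g)"
            using subspace_scale[OF subspace_null, of "T e - k *\<^sub>R e" "- 1 / (k - c)"] n0 by simp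
          then show ?thesis
            by (rule self_adjoint_null[OF S])
        qed
        have eq: "?S (t *\<^sub>R e + x - ?S (t *\<^sub>R g + w)) = t *\<^sub>R ?S (e - ?S g) + ?S (x - ?S w)"
          by (simp add: linear_add[OF lin] linear_scale[OF lin] linear_diff[OF lin] algebra_simps)
        have "null (?S (t *\<^sub>R e + x - ?S (t *\<^sub>R g + w)))"
          unfolding eq
          using subspace_add[OF subspace_null] subspace_scale[OF subspace_null] ng w(3) by blast
        moreover have "t *\<^sub>R g + w \<in> span ?E"
          using gE w by (intro span_add span_scale)
        moreover have "t *\<^sub>R g + w \<in> U"
          using gU w U by (intro subspace_add subspace_scale)
        ultimately show ?case
          by blast
      qed
      obtain w where w: "w \<in> span ?E" "w \<in> U" "null (?S (?S v - ?S w))"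
        using solve[OF Sv] by blast
      then have "null (?S (?S (v - w)))"
        using linear_diff[OF linS] by simp
      then have "null (?S (v - w))"
        by (rule null_image_if_null_square[OF S])
      moreover have "v - w \<in> U"
        using U w less.prems by (intro subspace_diff)
      ultimately have "v - w \<in> span ?E"
        by (intro span_base) (auto simp: eigenvector_def)
      then show ?thesis
        using span_add[OF w(1)] by fastforce
    next
      case (complex_roots a b s)
      let ?S = "\<lambda>u. T u - a *\<^sub>R u"
      define w where "w = poly_op T s v"
      have S: "self_adjoint ?S"
        by (rule self_adjoint_shift[OF T])
      have "poly_op T q v = poly_op T [:a\<^sup>2 + b\<^sup>2, - (2 * a), 1:] w"
        unfolding complex_roots w_def by (rule poly_op_mult[OF lin])
      also have "\<dots> = ?S (?S w) + b\<^sup>2 *\<^sub>R w"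
        by (simp add: poly_op_pCons[OF lin] linear_0[OF lin] linear_add[OF lin] linear_diff[OF lin]
            linear_scale[OF lin] power2_eq_square algebra_simps) (simp flip: scaleR_add_left)
      finally have "B (?S (?S w) + b\<^sup>2 *\<^sub>R w) w = 0"
        using less.prems null_left by metis
      moreover have "B (?S (?S w)) w = B (?S w) (?S w)"
        using S unfolding self_adjoint_def by metis
      ultimately have "B (?S w) (?S w) + b\<^sup>2 * B w w = 0"
        by (simp add: add_left scale_left)
      then have "b\<^sup>2 * B w w = 0"
        using nonneg[of "?S w"] nonneg[of w] zero_le_power2[of b]
        by (metis add_nonneg_eq_0_iff mult_nonneg_nonneg)
      then have "null w"
        using complex_roots null_if_norm_zero by auto
      moreover have "s \<noteq> 0"
        using less.prems complex_roots by auto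
      moreover from this have "degree s < degree q"
        by (simp add: complex_roots degree_mult_eq del: mult_pCons_left)
      ultimately show ?thesis
        using less unfolding w_def by metis
    qed
  qed
qed

text \<open>
  Operators are added one at a time. A joint eigenspace of the previous ones is invariant under the
  new operator, because the operators commute, and is spanned by eigenvectors of it.
\<close>

lemma in_span_joint_eigenvectors:
  fixes T :: "'i \<Rightarrow> 'a \<Rightarrow> 'a"
  assumes sa: "\<And>i. self_adjoint (T i)"
    and comm: "\<And>i j u. null (T i (T j u) - T j (T i u))"
    and fin: "finite F" "\<And>i u. T i u \<in> span F"
    and "finite K"
  shows "v \<in> span {u. \<forall>i\<in>K. \<exists>c. eigenvector (T i) c u}"
  using \<open>finite K\<close>
proof (induction K)
  case empty
  then show ?case by (simp add: span_base)
next
  case (insert j K)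
  let ?E = "\<lambda>K. {u. \<forall>i\<in>K. \<exists>c. eigenvector (T i) c u}"
  have "?E K \<subseteq> span (?E (insert j K))"
  proof
    fix e
    assume "e \<in> ?E K"
    then have "\<forall>i\<in>K. \<exists>c. eigenvector (T i) c e"
      by simp
    from bchoice[OF this] obtain c where c: "\<And>i. i \<in> K \<Longrightarrow> eigenvector (T i) (c i) e"
      by blast
    define U where "U = (\<Inter>i\<in>K. {u. eigenvector (T i) (c i) u})"
    have "subspace U"
      unfolding U_def using subspace_eigenvector[OF sa] by (auto intro: subspace_Inter)
    moreover have "T j u \<in> U" if "u \<in> U" for u
    proof -
      have "eigenvector (T i) (c i) (T j u)" if "i \<in> K" for i
      proof -
        have "null (T j (T i u - c i *\<^sub>R u))"
          using \<open>u \<in> U\<close> that by (auto simp: U_def eigenvector_def intro: self_adjoint_null[OF sa])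
        moreover have "T i (T j u) - c i *\<^sub>R T j u
            = T j (T i u - c i *\<^sub>R u) + (T i (T j u) - T j (T i u))"
          using sa[of j] by (simp add: self_adjoint_def linear_diff linear_scale)
        ultimately show ?thesis
          using comm[of i j u] unfolding eigenvector_def by (metis null_add)
      qed
      then show ?thesis
        by (simp add: U_def)
    qed
    moreover obtain q where "q \<noteq> 0" "poly_op (T j) q e = 0"
      using annihilating_polynomial_exists[of F "T j" e, OF fin] by blast
    moreover have "e \<in> U"
      using c by (simp add: U_def)
    ultimately have "e \<in> span {u \<in> U. \<exists>c. eigenvector (T j) c u}"
      using in_span_eigenvectors_if_annihilated[OF sa, of U j q e] by (simp add: null_def)
    also have "\<dots> \<subseteq> span (?E (insert j K))"
      by (rule span_mono) (auto simp: U_def)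
    finally show "e \<in> span (?E (insert j K))" .
  qed
  then show ?case
    using insert.IH span_minimal[OF _ subspace_span] by blast
qed

text \<open>
  Components with the same tuple of eigenvalues are added up. Two different tuples differ for some
  operator, and self-adjointness makes eigenvectors for different eigenvalues orthogonal.
\<close>

lemma orthogonal_joint_eigenvector_decomposition:
  fixes T :: "'i::finite \<Rightarrow> 'a \<Rightarrow> 'a"
  assumes sa: "\<And>i. self_adjoint (T i)"
    and comm: "\<And>i j u. null (T i (T j u) - T j (T i u))"
    and fin: "finite F" "\<And>i u. T i u \<in> span F"
  obtains A :: "(real^'i) set" and e
  where "finite A" "v = (\<Sum>a\<in>A. e a)"
    "\<And>a i. a \<in> A \<Longrightarrow> eigenvector (T i) (a $ i) (e a)"
    "\<And>a b. a \<in> A \<Longrightarrow> b \<in> A \<Longrightarrow> a \<noteq> b \<Longrightarrow> B (e a) (e b) = 0"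
proof -
  have "v \<in> span {u. \<forall>i\<in>UNIV. \<exists>c. eigenvector (T i) c u}"
    by (rule in_span_joint_eigenvectors[OF sa comm fin]) simp_all
  then obtain G r where G: "finite G" "v = (\<Sum>x\<in>G. r x *\<^sub>R x)"
    and GE: "G \<subseteq> {u. \<forall>i\<in>UNIV. \<exists>c. eigenvector (T i) c u}"
    unfolding span_explicit by blast
  have "\<forall>x\<in>G. \<exists>a::real^'i. \<forall>i. eigenvector (T i) (a $ i) x"
  proof
    fix x
    assume "x \<in> G"
    then have "\<forall>i. \<exists>c. eigenvector (T i) c x"
      using GE by blast
    from choice[OF this] obtain c where "\<And>i. eigenvector (T i) (c i) x"
      by blast
    then show "\<exists>a::real^'i. \<forall>i. eigenvector (T i) (a $ i) x"
      by (intro exI[of _ "\<chi> i. c i"]) simp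
  qed
  from bchoice[OF this] obtain c :: "'a \<Rightarrow> real^'i"
    where c: "\<And>x i. x \<in> G \<Longrightarrow> eigenvector (T i) (c x $ i) x"
    by blast
  define e where "e a = (\<Sum>x | x \<in> G \<and> c x = a. r x *\<^sub>R x)" for a
  have v: "v = (\<Sum>a\<in>c ` G. e a)"
    unfolding e_def using G by (subst sum.group) auto
  have eig: "eigenvector (T i) (a $ i) (e a)" for a i
  proof -
    have "e a \<in> {u. eigenvector (T i) (a $ i) u}"
      unfolding e_def
      by (intro subspace_sum subspace_scale subspace_eigenvector sa) (use c in auto)
    then show ?thesis by simp
  qed
  have "B (e a) (e b) = 0" if ab: "a \<noteq> b" for a b
  proof -
    obtain i where i: "a $ i \<noteq> b $ i"
      using ab by (auto simp: vec_eq_iff)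
    have "B (T i (e a) - (a $ i) *\<^sub>R e a) (e b) = 0"
      using eig null_left unfolding eigenvector_def by blast
    moreover have "B (e a) (T i (e b) - (b $ i) *\<^sub>R e b) = 0"
      using eig null_right unfolding eigenvector_def by blast
    moreover have "B (T i (e a)) (e b) = B (e a) (T i (e b))"
      using sa unfolding self_adjoint_def by blast
    ultimately have "(a $ i - b $ i) * B (e a) (e b) = 0"
      by (simp add: diff_left diff_right scale_left scale_right algebra_simps)
    then show ?thesis
      using i by simp
  qed
  then show thesis
    using that[of "c ` G" e] G v eig by blast
qed

end


section \<open>Monomials and Gram forms\<close>

lemma mdeg_add [simp]: "mdeg (\<alpha> + \<beta>) = mdeg \<alpha> + mdeg \<beta>"
  by (simp add: mdeg_def lookup_add sum.distrib)

lemma mdeg_zero [simp]: "mdeg 0 = 0"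
  by (simp add: mdeg_def)

definition var :: "'n \<Rightarrow> 'n::finite monom"
  where "var i = Poly_Mapping.single i 1"

lemma lookup_var: "Poly_Mapping.lookup (var i) j = (if j = i then 1 else 0)"
  by (auto simp: var_def lookup_single when_def)

lemma mdeg_var [simp]: "mdeg (var i) = 1"
  by (simp add: mdeg_def lookup_var)

lemma monom_eval_zero [simp]: "monom_eval x 0 = 1"
  by (simp add: monom_eval_def)

lemma monom_eval_add: "monom_eval x (\<alpha> + \<beta>) = monom_eval x \<alpha> * monom_eval x \<beta>"
  by (simp add: monom_eval_def lookup_add power_add prod.distrib)

lemma monom_eval_var [simp]: "monom_eval x (var i) = x $ i"
proof -
  have "monom_eval x (var i) = (\<Prod>j\<in>UNIV. if j = i then x $ j else 1)"
    unfolding monom_eval_def by (rule prod.cong) (auto simp: lookup_var)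
  then show ?thesis by simp
qed

lemma mdeg_eq_0_iff: "mdeg \<alpha> = 0 \<longleftrightarrow> \<alpha> = 0"
  by (auto simp: mdeg_def intro: poly_mapping_eqI)

lemma mdeg_SucE:
  assumes "mdeg \<alpha> = Suc n"
  obtains \<beta> i where "\<alpha> = \<beta> + var i" "mdeg \<beta> = n"
proof -
  have "\<exists>i. Poly_Mapping.lookup \<alpha> i \<noteq> 0"
    using assms unfolding mdeg_def by (metis Zero_not_Suc sum.neutral)
  then obtain i where i: "Poly_Mapping.lookup \<alpha> i \<noteq> 0" by blast
  define \<beta> where "\<beta> = \<alpha> - var i"
  have "\<alpha> = \<beta> + var i"
    using i by (intro poly_mapping_eqI) (auto simp: \<beta>_def lookup_add lookup_minus lookup_var)
  moreover from this have "mdeg \<beta> = n"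
    using assms by simp
  ultimately show thesis
    using that by blast
qed

lemma monom_split:
  assumes "mdeg \<gamma> \<le> k + l"
  obtains \<alpha> \<beta> where "\<gamma> = \<alpha> + \<beta>" "mdeg \<alpha> \<le> k" "mdeg \<beta> \<le> l"
  using assms
proof (induction k arbitrary: \<gamma> thesis)
  case 0
  then show ?case using 0(1)[of 0 \<gamma>] by simp
next
  case (Suc k)
  show ?case
  proof (cases "mdeg \<gamma>")
    case 0
    then show ?thesis using Suc.prems(1)[of 0 \<gamma>] by simp
  next
    case (Suc n)
    then obtain \<delta> i where \<delta>: "\<gamma> = \<delta> + var i" "mdeg \<delta> = n"
      by (rule mdeg_SucE)
    then obtain \<alpha> \<beta> where "\<delta> = \<alpha> + \<beta>" "mdeg \<alpha> \<le> k" "mdeg \<beta> \<le> l"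
      using Suc.IH[of \<delta>] Suc.prems(2) by auto
    then show ?thesis
      using Suc.prems(1)[of "\<alpha> + var i" \<beta>] \<delta> by (simp add: ac_simps)
  qed
qed

definition gram :: "'n monom set \<Rightarrow> 'n mmat \<Rightarrow> 'n mpoly \<Rightarrow> 'n mpoly \<Rightarrow> real"
  where "gram I M g h =
    (\<Sum>\<alpha>\<in>I. \<Sum>\<beta>\<in>I. Poly_Mapping.lookup g \<alpha> * M \<alpha> \<beta> * Poly_Mapping.lookup h \<beta>)"

lemma semi_inner_gram:
  assumes "psd_on I M"
  shows "semi_inner (gram I M)"
proof
  fix u v w :: "'a mpoly" and r :: real
  show "gram I M (u + v) w = gram I M u w + gram I M v w"
    by (simp add: gram_def lookup_add sum.distrib algebra_simps)
  show "gram I M (r *\<^sub>R u) w = r * gram I M u w"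
    by (simp add: gram_def sum_distrib_left mult.assoc)
  show "gram I M u v = gram I M v u"
    unfolding gram_def
    by (subst sum.swap) (use assms in \<open>auto simp: psd_on_def intro!: sum.cong\<close>)
  show "0 \<le> gram I M u u"
    using assms by (simp add: gram_def psd_on_def)
qed

lemma gram_single_left:
  assumes "finite I" "\<alpha> \<in> I"
  shows "gram I M (Poly_Mapping.single \<alpha> 1) h = (\<Sum>\<beta>\<in>I. M \<alpha> \<beta> * Poly_Mapping.lookup h \<beta>)"
proof -
  have "gram I M (Poly_Mapping.single \<alpha> 1) h
      = (\<Sum>\<delta>\<in>I. if \<delta> = \<alpha> then \<Sum>\<beta>\<in>I. M \<delta> \<beta> * Poly_Mapping.lookup h \<beta> else 0)"
    unfolding gram_def by (rule sum.cong) (auto simp: lookup_single when_def)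
  then show ?thesis
    using assms by simp
qed

lemma gram_single_single:
  assumes "finite I" "\<alpha> \<in> I" "\<beta> \<in> I"
  shows "gram I M (Poly_Mapping.single \<alpha> 1) (Poly_Mapping.single \<beta> 1) = M \<alpha> \<beta>"
proof -
  have "gram I M (Poly_Mapping.single \<alpha> 1) (Poly_Mapping.single \<beta> 1)
      = (\<Sum>\<delta>\<in>I. if \<delta> = \<beta> then M \<alpha> \<delta> else 0)"
    unfolding gram_single_left[OF assms(1,2)]
    by (rule sum.cong) (auto simp: lookup_single when_def)
  then show ?thesis
    using assms by simp
qed

lemma psd_on_subset:
  assumes "psd_on I M" "K \<subseteq> I" "finite I"
  shows "psd_on K M"
  unfolding psd_on_def
proof (intro conjI ballI allI)
  show "M \<alpha> \<beta> = M \<beta> \<alpha>" if "\<alpha> \<in> K" "\<beta> \<in> K" for \<alpha> \<beta>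
    using assms that by (auto simp: psd_on_def)
next
  fix v :: "'a mvec"
  define v' where "v' \<alpha> = (if \<alpha> \<in> K then v \<alpha> else 0)" for \<alpha>
  have "(\<Sum>\<alpha>\<in>K. \<Sum>\<beta>\<in>K. v \<alpha> * M \<alpha> \<beta> * v \<beta>) = (\<Sum>\<alpha>\<in>K. \<Sum>\<beta>\<in>K. v' \<alpha> * M \<alpha> \<beta> * v' \<beta>)"
    by (intro sum.cong) (auto simp: v'_def)
  also have "\<dots> = (\<Sum>\<alpha>\<in>K. \<Sum>\<beta>\<in>I. v' \<alpha> * M \<alpha> \<beta> * v' \<beta>)"
    using assms by (intro sum.cong sum.mono_neutral_left) (auto simp: v'_def)
  also have "\<dots> = (\<Sum>\<alpha>\<in>I. \<Sum>\<beta>\<in>I. v' \<alpha> * M \<alpha> \<beta> * v' \<beta>)"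
    using assms by (intro sum.mono_neutral_left) (auto simp: v'_def)
  finally show "0 \<le> (\<Sum>\<alpha>\<in>K. \<Sum>\<beta>\<in>K. v \<alpha> * M \<alpha> \<beta> * v \<beta>)"
    using assms(1) by (simp add: psd_on_def)
qed

text \<open>
  Column \<open>\<beta>\<close> of \<open>W\<close> holds the coefficients of the projection of the monomial \<open>\<beta>\<close> to the polynomials
  of degree at most \<open>d - 1\<close>, for the form given by \<open>M\<close>; orthogonality of the difference to the
  lower monomials is the required equation.
\<close>

lemma block_factor_exists:
  fixes M :: "'n::finite mmat"
  assumes "psd_on (monoms_upto d) M"
  shows "\<exists>W. block_factor d M W"
proof -
  let ?I = "monoms_upto d :: 'n monom set" and ?J = "monoms_upto (d - 1) :: 'n monom set"
  let ?X = "\<lambda>\<alpha>::'n monom. Poly_Mapping.single \<alpha> (1::real)"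
  interpret semi_inner "gram ?I M"
    by (rule semi_inner_gram[OF assms])
  have JI: "?J \<subseteq> ?I"
    by (auto simp: monoms_upto_def)
  have "\<exists>w\<in>span (?X ` ?J). \<forall>g\<in>?X ` ?J. gram ?I M (?X \<beta> - w) g = 0" for \<beta>
    by (rule orthogonal_projection_exists) simp
  then obtain w where w: "\<And>\<beta>. w \<beta> \<in> span (?X ` ?J)"
    and orth: "\<And>\<beta> \<alpha>. \<alpha> \<in> ?J \<Longrightarrow> gram ?I M (?X \<beta> - w \<beta>) (?X \<alpha>) = 0"
    by (metis image_eqI)
  have supp: "Poly_Mapping.lookup (w \<beta>) \<gamma> = 0" if "\<gamma> \<notin> ?J" for \<beta> \<gamma>
    using w[of \<beta>] that
    by (induction rule: span_induct) (auto simp: subspace_def lookup_add lookup_single when_def)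
  have "M \<alpha> \<beta> = (\<Sum>\<gamma>\<in>?J. M \<alpha> \<gamma> * Poly_Mapping.lookup (w \<beta>) \<gamma>)"
    if "\<alpha> \<in> ?J" "mdeg \<beta> = d" for \<alpha> \<beta>
  proof -
    have \<alpha>: "\<alpha> \<in> ?I" and \<beta>: "\<beta> \<in> ?I"
      using that JI by (auto simp: monoms_upto_def)
    have "M \<alpha> \<beta> = gram ?I M (?X \<alpha>) (?X \<beta>)"
      using \<alpha> \<beta> by (simp add: gram_single_single)
    also have "\<dots> = gram ?I M (?X \<alpha>) (w \<beta>)"
      using orth[OF that(1), of \<beta>] commute[of "?X \<alpha>" "?X \<beta> - w \<beta>"] by (simp add: diff_right)
    also have "\<dots> = (\<Sum>\<gamma>\<in>?I. M \<alpha> \<gamma> * Poly_Mapping.lookup (w \<beta>) \<gamma>)"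
      using \<alpha> by (simp add: gram_single_left)
    also have "\<dots> = (\<Sum>\<gamma>\<in>?J. M \<alpha> \<gamma> * Poly_Mapping.lookup (w \<beta>) \<gamma>)"
      using JI supp by (intro sum.mono_neutral_right) auto
    finally show ?thesis .
  qed
  then have "block_factor d M (\<lambda>\<gamma> \<beta>. Poly_Mapping.lookup (w \<beta>) \<gamma>)"
    by (simp add: block_factor_def)
  then show ?thesis
    by blast
qed


section \<open>Flat moment matrices\<close>

locale flat_moment_matrix =
  fixes d :: nat and M W :: "'n::finite mmat" and z :: "'n mvec"
  assumes d: "1 \<le> d"
    and psd: "psd_on (monoms_upto d) M"
    and W: "block_factor d M W"
    and hankel: "modified_with d M W = moment_matrix d z"
begin

definition J :: "'n monom set" where "J = monoms_upto (d - 1)"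
definition I :: "'n monom set" where "I = monoms_upto d"
abbreviation B :: "'n mpoly \<Rightarrow> 'n mpoly \<Rightarrow> real" where "B \<equiv> gram J M"
abbreviation X :: "'n monom \<Rightarrow> 'n mpoly" where "X \<alpha> \<equiv> Poly_Mapping.single \<alpha> 1"

lemma in_J: "\<alpha> \<in> J \<longleftrightarrow> mdeg \<alpha> \<le> d - 1"
  by (simp add: J_def monoms_upto_def)

lemma in_I: "\<alpha> \<in> I \<longleftrightarrow> mdeg \<alpha> \<le> d"
  by (simp add: I_def monoms_upto_def)

lemma finite_J [simp]: "finite J"
  by (simp add: J_def)

lemma J_subset_I: "J \<subseteq> I"
  by (auto simp: in_J in_I)

lemma mdeg_if_new: "\<alpha> \<in> I \<Longrightarrow> \<alpha> \<notin> J \<Longrightarrow> mdeg \<alpha> = d"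
  by (auto simp: in_J in_I)

lemma mult_var_in_I: "\<alpha> \<in> J \<Longrightarrow> \<alpha> + var i \<in> I"
  using d by (auto simp: in_J in_I)

sublocale semi_inner B
  using psd_on_subset[of I M J] psd J_subset_I by (intro semi_inner_gram) (simp add: I_def)

text \<open>
  A representative, of degree at most \<open>d - 1\<close>, of a monomial of degree at most \<open>d\<close> modulo the kernel
  of the modified matrix.
\<close>

definition reduce :: "'n monom \<Rightarrow> 'n mpoly"
  where "reduce \<alpha> = (if \<alpha> \<in> J then X \<alpha> else \<Sum>\<gamma>\<in>J. W \<gamma> \<alpha> *\<^sub>R X \<gamma>)"

text \<open>
  The four blocks of the modified matrix are the values of \<open>B\<close> at these representatives.
\<close>

lemma gram_reduce:
  assumes "\<alpha> \<in> I" "\<beta> \<in> I"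
  shows "B (reduce \<alpha>) (reduce \<beta>) = z (\<alpha> + \<beta>)"
proof -
  have "z (\<alpha> + \<beta>) = modified_with d M W \<alpha> \<beta>"
    using assms by (simp add: hankel moment_matrix_def I_def)
  also have "\<dots> = B (reduce \<alpha>) (reduce \<beta>)"
    unfolding modified_with_def Let_def J_def[symmetric]
    using mdeg_if_new[OF assms(1)] mdeg_if_new[OF assms(2)] d
    by (cases "\<alpha> \<in> J"; cases "\<beta> \<in> J")
      (simp_all add: reduce_def gram_single_single form_sums sum_left[of _ _ "X _"]
        sum_right[of "X _"] scale_left scale_right mult_ac)
  finally show ?thesis by simp
qed

text \<open>The modification touches only the block of degree \<open>d\<close> against degree \<open>d\<close>.\<close>

lemma hankel_agrees:
  assumes "\<alpha> \<in> J" "\<beta> \<in> I"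
  shows "z (\<alpha> + \<beta>) = M \<alpha> \<beta>"
proof -
  have "z (\<alpha> + \<beta>) = modified_with d M W \<alpha> \<beta>"
    using assms J_subset_I by (auto simp: hankel moment_matrix_def I_def)
  also have "\<dots> = M \<alpha> \<beta>"
  proof (cases "\<beta> \<in> J")
    case True
    then show ?thesis
      using assms unfolding modified_with_def Let_def J_def[symmetric] by simp
  next
    case False
    then have "mdeg \<beta> = d"
      using assms by (simp add: mdeg_if_new)
    moreover from this have "M \<alpha> \<beta> = (\<Sum>\<gamma>\<in>J. M \<alpha> \<gamma> * W \<gamma> \<beta>)"
      using W assms unfolding block_factor_def J_def by blast
    ultimately show ?thesis
      using assms False unfolding modified_with_def Let_def J_def[symmetric] by simp
  qed
  finally show ?thesis .
qed

definition mult_var :: "'n \<Rightarrow> 'n mpoly \<Rightarrow> 'n mpoly"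
  where "mult_var i g =
    (\<Sum>\<alpha>\<in>J. Poly_Mapping.lookup g \<alpha> *\<^sub>R reduce (\<alpha> + var i))"

lemma linear_mult_var: "linear (mult_var i)"
  by (rule linearI) (simp_all add: mult_var_def lookup_add scaleR_add_left sum.distrib scaleR_sum_right)

lemma mult_var_monomial: "\<alpha> \<in> J \<Longrightarrow> mult_var i (X \<alpha>) = reduce (\<alpha> + var i)"
proof -
  assume \<alpha>: "\<alpha> \<in> J"
  have "mult_var i (X \<alpha>)
      = (\<Sum>\<beta>\<in>J. if \<beta> = \<alpha> then reduce (\<beta> + var i) else 0)"
    unfolding mult_var_def by (rule sum.cong) (auto simp: lookup_single when_def)
  then show ?thesis
    using \<alpha> by simp
qed

lemma mult_var_in_span: "mult_var i g \<in> span (X ` J)"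
proof -
  have "reduce \<alpha> \<in> span (X ` J)" for \<alpha>
    by (cases "\<alpha> \<in> J") (auto simp: reduce_def intro: span_base intro!: span_sum span_scale)
  then show ?thesis
    unfolding mult_var_def by (intro span_sum span_scale)
qed

lemma form_expand_left: "B g h = (\<Sum>\<alpha>\<in>J. Poly_Mapping.lookup g \<alpha> * B (X \<alpha>) h)"
  by (simp add: gram_single_left) (simp add: gram_def sum_distrib_left mult.assoc)

lemma form_expand_right: "B g h = (\<Sum>\<beta>\<in>J. B g (X \<beta>) * Poly_Mapping.lookup h \<beta>)"
  unfolding commute[of g] form_expand_left[of h] by (simp add: mult.commute)

text \<open>
  The right-hand side is the functional \<open>z\<close> at the product of \<open>g\<close>, \<open>h\<close> and the variable. Its
  symmetry in \<open>g\<close> and \<open>h\<close> makes the operator self-adjoint.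
\<close>

lemma form_mult_var:
  "B (mult_var i g) h = (\<Sum>\<alpha>\<in>J. \<Sum>\<beta>\<in>J. Poly_Mapping.lookup g \<alpha> *
     z (\<alpha> + \<beta> + var i) * Poly_Mapping.lookup h \<beta>)"
proof -
  have "B (reduce (\<alpha> + var i)) h = (\<Sum>\<beta>\<in>J. z (\<alpha> + \<beta> + var i) * Poly_Mapping.lookup h \<beta>)"
    if \<alpha>: "\<alpha> \<in> J" for \<alpha>
  proof -
    have "B (reduce (\<alpha> + var i)) (X \<beta>) = z (\<alpha> + \<beta> + var i)" if \<beta>: "\<beta> \<in> J" for \<beta>
      using gram_reduce[of "\<alpha> + var i" \<beta>] mult_var_in_I \<alpha> \<beta> J_subset_I
      by (auto simp: reduce_def[of \<beta>] ac_simps)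
    then show ?thesis
      by (subst form_expand_right) simp
  qed
  then show ?thesis
    by (simp add: mult_var_def sum_left scale_left sum_distrib_left mult.assoc)
qed

lemma self_adjoint_mult_var: "self_adjoint (mult_var i)"
  unfolding self_adjoint_def
proof (intro conjI allI linear_mult_var)
  fix u v
  have "B (mult_var i u) v = B (mult_var i v) u"
    unfolding form_mult_var by (subst sum.swap) (simp add: ac_simps)
  then show "B (mult_var i u) v = B u (mult_var i v)"
    using commute[of u] by simp
qed

text \<open>
  This identity is symmetric in \<open>i\<close> and \<open>j\<close>, so moving both operators to the same side shows that
  they commute.
\<close>

lemma form_mult_var_mult_var:
  "B (mult_var i g) (mult_var j h) = (\<Sum>\<alpha>\<in>J. \<Sum>\<beta>\<in>J. Poly_Mapping.lookup g \<alpha> *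
     z (\<alpha> + \<beta> + var i + var j) * Poly_Mapping.lookup h \<beta>)"
proof -
  have "B (reduce (\<alpha> + var i)) (reduce (\<beta> + var j))
      = z (\<alpha> + \<beta> + var i + var j)"
    if "\<alpha> \<in> J" "\<beta> \<in> J" for \<alpha> \<beta>
    using that by (simp add: gram_reduce mult_var_in_I ac_simps)
  then show ?thesis
    by (simp add: mult_var_def form_sums mult_ac)
qed

lemma mult_var_commute: "null (mult_var i (mult_var j u) - mult_var j (mult_var i u))"
  unfolding null_def
proof
  fix w
  have "B (mult_var i (mult_var j u)) w = B (mult_var j u) (mult_var i w)"
    using self_adjoint_mult_var unfolding self_adjoint_def by blast
  also have "\<dots> = B (mult_var i u) (mult_var j w)"
    unfolding form_mult_var_mult_var by (simp add: ac_simps)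
  also have "\<dots> = B (mult_var j (mult_var i u)) w"
    using self_adjoint_mult_var unfolding self_adjoint_def by metis
  finally show "B (mult_var i (mult_var j u) - mult_var j (mult_var i u)) w = 0"
    by (simp add: diff_left)
qed

text \<open>
  A monomial is built from \<open>1\<close> by multiplying by one variable at a time, and up to null
  vectors \<open>mult_var i\<close> multiplies the component \<open>e a\<close> by \<open>a\<^sub>i\<close>. Only the last multiplication can reach
  degree \<open>d\<close>, so all intermediate monomials represent themselves.
\<close>

lemma reduce_eq_sum_eigenvectors:
  assumes one: "X 0 = (\<Sum>a\<in>A. e a)"
    and eig: "\<And>a i. a \<in> A \<Longrightarrow> eigenvector (mult_var i) (a $ i) (e a)"
    and "\<alpha> \<in> I"
  shows "null (reduce \<alpha> - (\<Sum>a\<in>A. monom_eval a \<alpha> *\<^sub>R e a))"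
  using \<open>\<alpha> \<in> I\<close>
proof (induction "mdeg \<alpha>" arbitrary: \<alpha>)
  case 0
  then have "\<alpha> = 0"
    by (simp add: mdeg_eq_0_iff)
  moreover from this have "reduce \<alpha> = X 0"
    by (simp add: reduce_def in_J)
  ultimately show ?case
    using one by (simp add: null_def)
next
  case (Suc n)
  from Suc(2)[symmetric] obtain \<beta> i where \<beta>: "\<alpha> = \<beta> + var i" "mdeg \<beta> = n"
    by (rule mdeg_SucE)
  have \<beta>J: "\<beta> \<in> J"
    using Suc(2,3) \<beta> by (auto simp: in_J in_I)
  let ?s = "\<Sum>a\<in>A. monom_eval a \<beta> *\<^sub>R e a"
  have n1: "null (mult_var i (reduce \<beta> - ?s))"
    using Suc(1)[of \<beta>] \<beta> \<beta>J J_subset_I by (intro self_adjoint_null[OF self_adjoint_mult_var]) auto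
  have n2: "null (\<Sum>a\<in>A. monom_eval a \<beta> *\<^sub>R (mult_var i (e a) - (a $ i) *\<^sub>R e a))"
  proof -
    have "(\<Sum>a\<in>A. monom_eval a \<beta> *\<^sub>R (mult_var i (e a) - (a $ i) *\<^sub>R e a)) \<in> {u. null u}"
      by (intro subspace_sum subspace_scale subspace_null) (use eig in \<open>auto simp: eigenvector_def\<close>)
    then show ?thesis by simp
  qed
  have eq: "reduce \<alpha> - (\<Sum>a\<in>A. monom_eval a \<alpha> *\<^sub>R e a) = mult_var i (reduce \<beta> - ?s)
      + (\<Sum>a\<in>A. monom_eval a \<beta> *\<^sub>R (mult_var i (e a) - (a $ i) *\<^sub>R e a))"
  proof -
    have "mult_var i (reduce \<beta>) = reduce \<alpha>"
      using \<beta>J \<beta> mult_var_monomial by (simp add: reduce_def)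
    moreover have "mult_var i ?s = (\<Sum>a\<in>A. monom_eval a \<beta> *\<^sub>R mult_var i (e a))"
      by (simp add: linear_sum[OF linear_mult_var] linear_scale[OF linear_mult_var])
    ultimately show ?thesis
      by (simp add: linear_diff[OF linear_mult_var] scaleR_diff_right sum_subtractf \<beta>
          monom_eval_add)
  qed
  show ?case
    unfolding eq by (rule null_add[OF n1 n2])
qed

lemma atomic_decomposition:
  obtains A :: "(real^'n) set" and e
  where "finite A" "\<And>a. a \<in> A \<Longrightarrow> B (e a) (e a) > 0"
    "\<And>a i. a \<in> A \<Longrightarrow> eigenvector (mult_var i) (a $ i) (e a)"
    "\<And>\<alpha> \<beta>. \<alpha> \<in> I \<Longrightarrow> \<beta> \<in> I \<Longrightarrow>
      z (\<alpha> + \<beta>) = (\<Sum>a\<in>A. B (e a) (e a) * (monom_eval a \<alpha> * monom_eval a \<beta>))"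
proof -
  have fin: "finite (X ` J)" by simp
  obtain A :: "(real^'n) set" and e where A: "finite A" "X 0 = (\<Sum>a\<in>A. e a)"
    and eig: "\<And>a i. a \<in> A \<Longrightarrow> eigenvector (mult_var i) (a $ i) (e a)"
    and orth: "\<And>a b. a \<in> A \<Longrightarrow> b \<in> A \<Longrightarrow> a \<noteq> b \<Longrightarrow> B (e a) (e b) = 0"
    by (rule orthogonal_joint_eigenvector_decomposition
        [of mult_var "X ` J" "X 0", OF self_adjoint_mult_var mult_var_commute fin mult_var_in_span])
      (assumption | rule that)+
  \<comment> \<open>Components of seminorm zero contribute nothing; dropping them leaves positive weights.\<close>
  define A' where "A' = {a \<in> A. B (e a) (e a) \<noteq> 0}"
  have "z (\<alpha> + \<beta>) = (\<Sum>a\<in>A'. B (e a) (e a) * (monom_eval a \<alpha> * monom_eval a \<beta>))"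
    if "\<alpha> \<in> I" "\<beta> \<in> I" for \<alpha> \<beta>
  proof -
    let ?s = "\<lambda>\<alpha>. \<Sum>a\<in>A. monom_eval a \<alpha> *\<^sub>R e a"
    have n: "null (reduce \<alpha> - ?s \<alpha>)" "null (reduce \<beta> - ?s \<beta>)"
      using reduce_eq_sum_eigenvectors[OF A(2) eig] that by blast+
    have "z (\<alpha> + \<beta>) = B (reduce \<alpha>) (reduce \<beta>)"
      using that gram_reduce by simp
    also have "\<dots> = B (?s \<alpha>) (reduce \<beta>)"
      using null_left[OF n(1), of "reduce \<beta>"] by (simp add: diff_left)
    also have "\<dots> = B (?s \<alpha>) (?s \<beta>)"
      using null_right[OF n(2), of "?s \<alpha>"] by (simp add: diff_right)
    also have "\<dots> = (\<Sum>a\<in>A. \<Sum>b\<in>A. monom_eval a \<alpha> * monom_eval b \<beta> * B (e a) (e b))"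
      by (rule form_sums)
    also have "\<dots> = (\<Sum>a\<in>A. \<Sum>b\<in>A. if b = a then monom_eval a \<alpha> * monom_eval a \<beta> * B (e a) (e a) else 0)"
      using orth by (intro sum.cong) auto
    also have "\<dots> = (\<Sum>a\<in>A. B (e a) (e a) * (monom_eval a \<alpha> * monom_eval a \<beta>))"
      using A(1) by (simp add: mult_ac)
    also have "\<dots> = (\<Sum>a\<in>A'. B (e a) (e a) * (monom_eval a \<alpha> * monom_eval a \<beta>))"
      using A(1) by (intro sum.mono_neutral_right) (auto simp: A'_def)
    finally show ?thesis .
  qed
  moreover have "B (e a) (e a) > 0" if "a \<in> A'" for a
    using that nonneg[of "e a"] by (auto simp: A'_def less_le)
  moreover have "finite A'"
    using A by (simp add: A'_def)
  moreover have "eigenvector (mult_var i) (a $ i) (e a)" if "a \<in> A'" for a i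
    using that eig by (simp add: A'_def)
  ultimately show thesis
    using that by blast
qed

text \<open>
  The monomials of \<open>p\<close> are \<open>1\<close> and the variables; each acts on the eigenvector \<open>g\<close> as its value at
  \<open>a\<close>.
\<close>

lemma localizing_form_eigenvector:
  assumes "p \<in> polys_upto 1"
    and eig: "\<And>i. eigenvector (mult_var i) (a $ i) g"
  shows "(\<Sum>\<alpha>\<in>J. \<Sum>\<beta>\<in>J. Poly_Mapping.lookup g \<alpha> *
       (\<Sum>\<gamma>\<in>Poly_Mapping.keys p. Poly_Mapping.lookup p \<gamma> * z (\<alpha> + \<beta> + \<gamma>)) *
       Poly_Mapping.lookup g \<beta>)
     = poly_eval p a * B g g"
proof -
  have mono: "(\<Sum>\<alpha>\<in>J. \<Sum>\<beta>\<in>J. Poly_Mapping.lookup g \<alpha> * z (\<alpha> + \<beta> + \<gamma>) * Poly_Mapping.lookup g \<beta>)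
      = monom_eval a \<gamma> * B g g" if "mdeg \<gamma> \<le> 1" for \<gamma>
  proof (cases "mdeg \<gamma>")
    case 0
    then have "\<gamma> = 0"
      by (simp add: mdeg_eq_0_iff)
    moreover have "z (\<alpha> + \<beta>) = M \<alpha> \<beta>" if "\<alpha> \<in> J" "\<beta> \<in> J" for \<alpha> \<beta>
      using that J_subset_I hankel_agrees by blast
    ultimately show ?thesis
      by (simp add: gram_def)
  next
    case (Suc n)
    then obtain \<delta> i where "\<gamma> = \<delta> + var i" "mdeg \<delta> = n"
      by (rule mdeg_SucE)
    then have \<gamma>: "\<gamma> = var i"
      using that Suc by (simp add: mdeg_eq_0_iff)
    have "B (mult_var i g - (a $ i) *\<^sub>R g) g = 0"
      using eig null_left unfolding eigenvector_def by blast
    then show ?thesis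
      using \<gamma> form_mult_var[of i g g] by (simp add: diff_left scale_left)
  qed
  have "(\<Sum>\<alpha>\<in>J. \<Sum>\<beta>\<in>J. Poly_Mapping.lookup g \<alpha> *
       (\<Sum>\<gamma>\<in>Poly_Mapping.keys p. Poly_Mapping.lookup p \<gamma> * z (\<alpha> + \<beta> + \<gamma>)) *
       Poly_Mapping.lookup g \<beta>)
     = (\<Sum>\<alpha>\<in>J. \<Sum>\<beta>\<in>J. \<Sum>\<gamma>\<in>Poly_Mapping.keys p. Poly_Mapping.lookup p \<gamma> *
       (Poly_Mapping.lookup g \<alpha> * z (\<alpha> + \<beta> + \<gamma>) * Poly_Mapping.lookup g \<beta>))"
    by (simp add: sum_distrib_left sum_distrib_right mult_ac)
  also have "\<dots> = (\<Sum>\<alpha>\<in>J. \<Sum>\<gamma>\<in>Poly_Mapping.keys p. \<Sum>\<beta>\<in>J. Poly_Mapping.lookup p \<gamma> *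
       (Poly_Mapping.lookup g \<alpha> * z (\<alpha> + \<beta> + \<gamma>) * Poly_Mapping.lookup g \<beta>))"
    by (intro sum.cong refl sum.swap)
  also have "\<dots> = (\<Sum>\<gamma>\<in>Poly_Mapping.keys p. \<Sum>\<alpha>\<in>J. \<Sum>\<beta>\<in>J. Poly_Mapping.lookup p \<gamma> *
       (Poly_Mapping.lookup g \<alpha> * z (\<alpha> + \<beta> + \<gamma>) * Poly_Mapping.lookup g \<beta>))"
    by (rule sum.swap)
  also have "\<dots> = (\<Sum>\<gamma>\<in>Poly_Mapping.keys p. Poly_Mapping.lookup p \<gamma> * (monom_eval a \<gamma> * B g g))"
    using assms(1) mono unfolding sum_distrib_left[symmetric]
    by (intro sum.cong) (auto simp: polys_upto_def monoms_upto_def)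
  also have "\<dots> = poly_eval p a * B g g"
    by (simp add: poly_eval_def sum_distrib_right mult.assoc)
  finally show ?thesis .
qed

end


section \<open>The moment relaxation\<close>

lemma poly_eval_upto:
  "f \<in> polys_upto k \<Longrightarrow> poly_eval f x = (\<Sum>\<alpha>\<in>monoms_upto k. Poly_Mapping.lookup f \<alpha> * monom_eval x \<alpha>)"
  unfolding poly_eval_def polys_upto_def
  by (intro sum.mono_neutral_left) (auto simp: in_keys_iff)

text \<open>The localizing matrix of a point evaluation is \<open>p(x)\<close> times a matrix of rank one.\<close>

lemma psd_on_localizing_matrix_point:
  assumes "poly_eval p x \<ge> 0"
  shows "psd_on (monoms_upto (loc_order k p)) (localizing_matrix k p (monom_eval x))"
proof -
  let ?L = "monoms_upto (loc_order k p)"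
  have eq: "localizing_matrix k p (monom_eval x) \<alpha> \<beta> = poly_eval p x * (monom_eval x \<alpha> * monom_eval x \<beta>)"
    if "\<alpha> \<in> ?L" "\<beta> \<in> ?L" for \<alpha> \<beta>
    using that by (simp add: localizing_matrix_def poly_eval_def monom_eval_add sum_distrib_left sum_distrib_right mult_ac)
  have "0 \<le> (\<Sum>\<alpha>\<in>?L. \<Sum>\<beta>\<in>?L. v \<alpha> * localizing_matrix k p (monom_eval x) \<alpha> \<beta> * v \<beta>)" for v
  proof -
    have "(\<Sum>\<alpha>\<in>?L. \<Sum>\<beta>\<in>?L. v \<alpha> * localizing_matrix k p (monom_eval x) \<alpha> \<beta> * v \<beta>)
        = (\<Sum>\<alpha>\<in>?L. \<Sum>\<beta>\<in>?L. poly_eval p x * ((v \<alpha> * monom_eval x \<alpha>) * (v \<beta> * monom_eval x \<beta>)))"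
      by (intro sum.cong) (auto simp: eq)
    also have "\<dots> = poly_eval p x * ((\<Sum>\<alpha>\<in>?L. v \<alpha> * monom_eval x \<alpha>) * (\<Sum>\<alpha>\<in>?L. v \<alpha> * monom_eval x \<alpha>))"
      unfolding sum_product by (simp add: sum_distrib_left)
    also have "\<dots> \<ge> 0"
      using assms by (intro mult_nonneg_nonneg zero_le_square)
    finally show ?thesis .
  qed
  then show ?thesis
    by (auto simp: psd_on_def eq)
qed

lemma monom_eval_feasible:
  assumes "x \<in> polyhedron_of m p"
  shows "monom_eval x \<in> relax_feasible k m p"
proof -
  have "poly_eval 1 x = 1"
    by (simp add: poly_eval_def)
  then show ?thesis
    using assms psd_on_localizing_matrix_point[of 1 x k] psd_on_localizing_matrix_point[of "p _" x k]
    by (auto simp: relax_feasible_def polyhedron_of_def)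
qed

lemma relax_value_optimal:
  assumes "relax_optimal k f m p y"
  shows "relax_value k f m p = ereal (relax_objective k f y)"
  unfolding relax_value_def
  using assms by (intro antisym INF_lower INF_greatest) (auto simp: relax_optimal_def)

lemma opt_value_global_minimizer:
  assumes "global_minimizer f S a"
  shows "opt_value f S = ereal (poly_eval f a)"
  unfolding opt_value_def
  using assms by (intro antisym INF_lower INF_greatest) (auto simp: global_minimizer_def)

lemma convex_combination_of_upper_bounds:
  fixes w h :: "'a \<Rightarrow> real"
  assumes "finite A" "\<And>a. a \<in> A \<Longrightarrow> w a > 0" "(\<Sum>a\<in>A. w a) = 1"
    and "\<And>a. a \<in> A \<Longrightarrow> c \<le> h a" "(\<Sum>a\<in>A. w a * h a) = c" "a \<in> A"
  shows "h a = c"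
proof -
  have "(\<Sum>a\<in>A. w a * (h a - c)) = (\<Sum>a\<in>A. w a * h a) - (\<Sum>a\<in>A. w a) * c"
    by (simp add: right_diff_distrib sum_subtractf sum_distrib_right)
  then have "(\<Sum>a\<in>A. w a * (h a - c)) = 0"
    using assms by simp
  moreover have "\<forall>a\<in>A. 0 \<le> w a * (h a - c)"
    using assms(2,4) by (simp add: less_imp_le)
  ultimately have "w a * (h a - c) = 0"
    using assms(1,6) by (simp add: sum_nonneg_eq_0_iff)
  then show ?thesis
    using assms(2)[OF assms(6)] by simp
qed

theorem theorem2p10:
  fixes f :: "'n::finite mpoly"
    and p :: "nat \<Rightarrow> 'n mpoly"
    and m d :: nat
    and y :: "'n mvec"
    and S :: "(real^'n) set"
  assumes "d \<ge> 1"
    and "f \<in> polys_upto (2 * d)"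
    and "\<And>i. i \<in> {1..m} \<Longrightarrow> p i \<in> polys_upto 1"
    and "S = polyhedron_of m p"
    and "relax_optimal (2 * d) f m p y"
    and "generalized_Hankel d (modified_matrix d (moment_matrix d y))"
  shows "\<exists>(r::nat) (a :: nat \<Rightarrow> real^'n) (w :: nat \<Rightarrow> real).
           r \<ge> 1 \<and>
           (\<forall>i\<in>{1..r}. a i \<in> S \<and> w i > 0) \<and>
           modified_matrix d (moment_matrix d y) =
             (\<lambda>\<alpha> \<beta>. \<Sum>i=1..r. w i * (V d (a i) \<alpha> * V d (a i) \<beta>)) \<and>
           (f \<in> polys_upto (2 * d - 1) \<longrightarrow>
             (\<forall>i\<in>{1..r}. global_minimizer f S (a i) \<and>
                opt_value f S = relax_value (2 * d) f m p \<and>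
                relax_value (2 * d) f m p = ereal (poly_eval f (a i))))"
proof -
  define M where "M = moment_matrix d y"
  have y: "y \<in> relax_feasible (2 * d) m p"
    using assms(5) by (simp add: relax_optimal_def)
  have "loc_order (2 * d) (1 :: 'n mpoly) = d"
    by (simp add: loc_order_def pdeg_def)
  then have psd: "psd_on (monoms_upto d) M"
    using y by (simp add: relax_feasible_def localizing_matrix_one M_def)
  define W where "W = (SOME W. block_factor d M W)"
  have W: "block_factor d M W"
    unfolding W_def using block_factor_exists[OF psd] by (rule someI_ex)
  have mod: "modified_matrix d (moment_matrix d y) = modified_with d M W"
    by (simp add: modified_matrix_def M_def W_def)
  then obtain z where z: "modified_with d M W = moment_matrix d z"
    using assms(6) by (auto simp: generalized_Hankel_def)
  interpret flat_moment_matrix d M W z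
    by unfold_locales (fact assms(1) psd W z)+
  have zy: "z (\<alpha> + \<beta>) = y (\<alpha> + \<beta>)" if "\<alpha> \<in> J" "\<beta> \<in> I" for \<alpha> \<beta>
    using hankel_agrees[OF that] that J_subset_I by (auto simp: M_def moment_matrix_def I_def)
  have zy_deg: "z \<gamma> = y \<gamma>" if "mdeg \<gamma> \<le> 2 * d - 1" for \<gamma>
  proof -
    have "mdeg \<gamma> \<le> (d - 1) + d"
      using that by simp
    then obtain \<alpha> \<beta> where "\<gamma> = \<alpha> + \<beta>" "mdeg \<alpha> \<le> d - 1" "mdeg \<beta> \<le> d"
      by (rule monom_split)
    then show ?thesis
      using zy[of \<alpha> \<beta>] by (simp add: in_J in_I)
  qed
  obtain A :: "(real^'n) set" and e where A: "finite A"
    and pos: "\<And>a. a \<in> A \<Longrightarrow> B (e a) (e a) > 0"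
    and eig: "\<And>a i. a \<in> A \<Longrightarrow> eigenvector (mult_var i) (a $ i) (e a)"
    and moments: "\<And>\<alpha> \<beta>. \<alpha> \<in> I \<Longrightarrow> \<beta> \<in> I \<Longrightarrow>
      z (\<alpha> + \<beta>) = (\<Sum>a\<in>A. B (e a) (e a) * (monom_eval a \<alpha> * monom_eval a \<beta>))"
    by (rule atomic_decomposition) blast
  define weight where "weight a = B (e a) (e a)" for a
  have AS: "a \<in> S" if a: "a \<in> A" for a
  proof -
    have "poly_eval (p i) a \<ge> 0" if i: "i \<in> {1..m}" for i
    proof -
      let ?L = "monoms_upto (loc_order (2 * d) (p i)) :: 'n monom set"
      have p1: "p i \<in> polys_upto 1"
        using assms(3) i .
      then have "pdeg (p i) \<le> 1"
        by (auto simp: pdeg_def polys_upto_def monoms_upto_def)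
      \<comment> \<open>The localizing matrix has order \<open>d - 1\<close>, or \<open>d\<close> if \<open>p i\<close> is constant.\<close>
      then have JL: "J \<subseteq> ?L"
        by (auto simp: in_J monoms_upto_def loc_order_def)
      have "psd_on ?L (localizing_matrix (2 * d) (p i) y)"
        using y i unfolding relax_feasible_def by blast
      then have "psd_on J (localizing_matrix (2 * d) (p i) y)"
        by (rule psd_on_subset) (simp_all add: JL)
      then have "0 \<le> (\<Sum>\<alpha>\<in>J. \<Sum>\<beta>\<in>J. Poly_Mapping.lookup (e a) \<alpha> *
          localizing_matrix (2 * d) (p i) y \<alpha> \<beta> * Poly_Mapping.lookup (e a) \<beta>)"
        by (simp add: psd_on_def)
      also have "\<dots> = (\<Sum>\<alpha>\<in>J. \<Sum>\<beta>\<in>J. Poly_Mapping.lookup (e a) \<alpha> *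
          (\<Sum>\<gamma>\<in>Poly_Mapping.keys (p i). Poly_Mapping.lookup (p i) \<gamma> * z (\<alpha> + \<beta> + \<gamma>)) *
          Poly_Mapping.lookup (e a) \<beta>)"
      proof -
        have "localizing_matrix (2 * d) (p i) y \<alpha> \<beta>
            = (\<Sum>\<gamma>\<in>Poly_Mapping.keys (p i). Poly_Mapping.lookup (p i) \<gamma> * z (\<alpha> + \<beta> + \<gamma>))"
          if "\<alpha> \<in> J" "\<beta> \<in> J" for \<alpha> \<beta>
        proof -
          have "z (\<alpha> + \<beta> + \<gamma>) = y (\<alpha> + \<beta> + \<gamma>)" if "\<gamma> \<in> Poly_Mapping.keys (p i)" for \<gamma>
          proof (rule zy_deg)
            have "mdeg \<gamma> \<le> 1"
              using p1 that by (auto simp: polys_upto_def monoms_upto_def)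
            then show "mdeg (\<alpha> + \<beta> + \<gamma>) \<le> 2 * d - 1"
              using \<open>\<alpha> \<in> J\<close> \<open>\<beta> \<in> J\<close> assms(1) by (simp add: in_J)
          qed
          then show ?thesis
            using that JL by (auto simp: localizing_matrix_def intro!: sum.cong)
        qed
        then show ?thesis
          by simp
      qed
      also have "\<dots> = poly_eval (p i) a * weight a"
        unfolding weight_def by (rule localizing_form_eigenvector[OF p1 eig[OF a]])
      finally show ?thesis
        using pos[OF a] by (simp add: weight_def zero_le_mult_iff)
    qed
    then show ?thesis
      by (simp add: assms(4) polyhedron_of_def)
  qed
  have mass: "(\<Sum>a\<in>A. weight a) = 1"
  proof -
    have "z (0 + 0) = y (0 + 0)"
      by (rule zy_deg) simp
    then have "z (0 + 0) = 1"
      using y by (simp add: relax_feasible_def)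
    then show ?thesis
      using moments[of 0 0] by (simp add: weight_def in_I)
  qed
  have decomp: "modified_matrix d (moment_matrix d y) \<alpha> \<beta> = (\<Sum>a\<in>A. weight a * (V d a \<alpha> * V d a \<beta>))" for \<alpha> \<beta>
    unfolding mod z using moments by (auto simp: moment_matrix_def V_def weight_def I_def)
  have minimizers: "global_minimizer f S a \<and> opt_value f S = relax_value (2 * d) f m p \<and>
      relax_value (2 * d) f m p = ereal (poly_eval f a)"
    if a: "a \<in> A" and f: "f \<in> polys_upto (2 * d - 1)" for a
  proof -
    let ?v = "relax_objective (2 * d) f y"
    have lower: "?v \<le> poly_eval f x" if "x \<in> S" for x
    proof -
      have "?v \<le> relax_objective (2 * d) f (monom_eval x)"
        using assms(4,5) monom_eval_feasible[of x m p "2 * d"] that unfolding relax_optimal_def by blast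
      then show ?thesis
        using poly_eval_upto[OF assms(2)] by (simp add: relax_objective_def)
    qed
    have "(\<Sum>a\<in>A. weight a * poly_eval f a) = ?v"
    proof -
      have "?v = (\<Sum>\<gamma>\<in>monoms_upto (2 * d). Poly_Mapping.lookup f \<gamma> *
          (\<Sum>a\<in>A. weight a * monom_eval a \<gamma>))"
        unfolding relax_objective_def
      proof (intro sum.cong refl)
        fix \<gamma> :: "'n monom"
        assume "\<gamma> \<in> monoms_upto (2 * d)"
        then have "mdeg \<gamma> \<le> d + d"
          by (simp add: monoms_upto_def)
        then obtain \<alpha> \<beta> where \<gamma>: "\<gamma> = \<alpha> + \<beta>" "mdeg \<alpha> \<le> d" "mdeg \<beta> \<le> d"
          by (rule monom_split)
        then have "z \<gamma> = (\<Sum>a\<in>A. weight a * monom_eval a \<gamma>)"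
          using moments[of \<alpha> \<beta>] by (simp add: weight_def in_I monom_eval_add)
        moreover have "Poly_Mapping.lookup f \<gamma> * y \<gamma> = Poly_Mapping.lookup f \<gamma> * z \<gamma>"
        proof (cases "Poly_Mapping.lookup f \<gamma> = 0")
          case False
          then have "mdeg \<gamma> \<le> 2 * d - 1"
            using f by (auto simp: polys_upto_def monoms_upto_def in_keys_iff)
          then show ?thesis
            using zy_deg by simp
        qed simp
        ultimately show "Poly_Mapping.lookup f \<gamma> * y \<gamma>
            = Poly_Mapping.lookup f \<gamma> * (\<Sum>a\<in>A. weight a * monom_eval a \<gamma>)"
          by simp
      qed
      also have "\<dots> = (\<Sum>\<gamma>\<in>monoms_upto (2 * d). \<Sum>a\<in>A. weight a * (Poly_Mapping.lookup f \<gamma> * monom_eval a \<gamma>))"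
        by (simp add: sum_distrib_left mult_ac)
      also have "\<dots> = (\<Sum>a\<in>A. weight a * poly_eval f a)"
        unfolding poly_eval_upto[OF assms(2)] sum_distrib_left by (rule sum.swap)
      finally show ?thesis
        by simp
    qed
    then have fa: "poly_eval f a = ?v"
      using convex_combination_of_upper_bounds[of A weight ?v "poly_eval f" a] A pos mass AS lower a
      by (simp add: weight_def)
    have "global_minimizer f S a"
      using AS[OF a] lower fa by (simp add: global_minimizer_def)
    then show ?thesis
      using opt_value_global_minimizer[of f S a] relax_value_optimal[OF assms(5)] fa by simp
  qed
  obtain h where h: "bij_betw h {1..card A} A"
    using A ex_bij_betw_nat_finite_1 by blast
  have hA: "h i \<in> A" if "i \<in> {1..card A}" for i
    using h that bij_betwE by blast
  have "A \<noteq> {}"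
    using mass by auto
  then have "card A \<ge> 1"
    using A by (simp add: Suc_leI card_gt_0_iff)
  moreover have "\<forall>i\<in>{1..card A}. h i \<in> S \<and> (weight \<circ> h) i > 0"
    using hA AS pos by (simp add: weight_def)
  moreover have "modified_matrix d (moment_matrix d y) =
      (\<lambda>\<alpha> \<beta>. \<Sum>i=1..card A. (weight \<circ> h) i * (V d (h i) \<alpha> * V d (h i) \<beta>))"
  proof (intro ext)
    fix \<alpha> \<beta>
    show "modified_matrix d (moment_matrix d y) \<alpha> \<beta>
        = (\<Sum>i=1..card A. (weight \<circ> h) i * (V d (h i) \<alpha> * V d (h i) \<beta>))"
      unfolding decomp sum.reindex_bij_betw[OF h, symmetric] by simp
  qed
  moreover have "f \<in> polys_upto (2 * d - 1) \<longrightarrow>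
      (\<forall>i\<in>{1..card A}. global_minimizer f S (h i) \<and>
        opt_value f S = relax_value (2 * d) f m p \<and>
        relax_value (2 * d) f m p = ereal (poly_eval f (h i)))"
    using minimizers hA by blast
  ultimately show ?thesis
    by blast
qed

end
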